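(* Let $(\mathcal Q,d)$ be a Hadamard space, let $Y$ be a $\mathcal Q$-valued random variable concentrated on a separable set, let $m$ be a Fréchet median of $Y$, and for $n\in\mathbb N$ let $m_n$ be an empirical Fréchet median of $Y_1,\dots,Y_n$, where $Y_1,Y_2,\dots$ are independent copies of $Y$. Assume there exists $\xi\in(0,\infty)$ with $\mathbf E[d(Y,m)^\xi]<\infty$. Let $r\in(0,\infty)$ be such that $\mathbf P(d(Y,m)>r)<\frac1{27}$. Set $R:=6r$. Assume there are $\ell\in\mathbb N$ and $w\in(0,1]$ such that $$\sup_{p\in\overline{\mathrm B}(m,R)}\mathbf P\big(Y\in\bowtie(m,p,w)\big)<1$$ and $$\mathbf P\Big(\exists\,q,p\in\overline{\mathrm B}(m,R)\colon\;Y_1,\dots,Y_\ell\in\bowtie(q,p,w)\cup\big(\mathcal Q\setminus\overline{\mathrm B}(m,R)\big)\Big)<1.$$ Then $$\mathbf E\big[d(m,m_n)^2\big]=O\Big(\frac1n\Big)\qquad\text{as }n\to\infty.$$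
   Context: A Hadamard space is a nonempty complete metric space $(\mathcal Q,d)$ such that for all $y_0,y_1\in\mathcal Q$ there is $p\in\mathcal Q$ with $\frac12 d(y_0,q)^2+\frac12 d(y_1,q)^2-\frac14 d(y_0,y_1)^2\ge d(q,p)^2$ for all $q\in\mathcal Q$; it carries its Borel $\sigma$-algebra. "Concentrated on a separable set" means $\mathbf P(Y\in\mathcal Y)=1$ for some separable $\mathcal Y\subset\mathcal Q$. $\overline{\mathrm B}(m,R)=\{q\in\mathcal Q: d(q,m)\le R\}$. A Fréchet median of $Y$ is any $m\in\arg\min_{q\in\mathcal Q}\mathbf E[d(Y,q)-d(Y,o)]$ with an arbitrary reference point $o\in\mathcal Q$ (independent of $o$). $m_n\in\arg\min_{q\in\mathcal Q}\sum_{j=1}^n d(Y_j,q)$ is a measurable function of $(Y_1,\dots,Y_n)$. Bow tie: any two points $q\ne p$ of $\mathcal Q$ are joined by a unique unit-speed geodesic $\gamma_{q\to p}\colon[0,d(q,p)]\to\mathcal Q$ with $\gamma_{q\to p}(0)=q$, $\gamma_{q\to p}(d(q,p))=p$. For $y\in\mathcal Q$ let $f_y(t):=d(y,\gamma_{q\to p}(t))$, with right derivative $f_y^{\oplus}(0)$ at $0$ and left derivative $f_y^{\ominus}(d(q,p))$ at $d(q,p)$. For $w\in[0,1]$ the bow tie between the knots $q$ and $p$ with widening $w$ is $$\bowtie(q,p,w):=\Big\{y\in\mathcal Q:\max\big(f_y^{\oplus}(0)^2,\,f_y^{\ominus}(d(q,p))^2\big)\ge1-w^2\Big\};$$ moreover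 $\bowtie(q,q,w):=\{q\}$ for $w\in[0,1)$ and $\bowtie(q,q,1):=\mathcal Q$. Measurability convention: events and functions involving an existential quantifier or an infimum over $q,p\in\overline{\mathrm B}(m,R)$ (such as the event in the second displayed condition, and $\inf_{q,p\in\overline{\mathrm B}(m,R)}\frac1n\sum_{j=1}^n\mathbf 1\{Y_j\notin\bowtie(q,p,w),\,d(Y_j,m)\le R\}$) are assumed measurable. The $O$-statement means that there are $C<\infty$ and $n_0$ with the left side at most $C/n$ for all $n\ge n_0$. *)

theory Defs
  imports "HOL-Probability.Probability"
begin

class hadamard_space = complete_space +
  assumes hadamard_midpoint:
    "\<exists>p. \<forall>q. (1/2) * (dist y0 q)\<^sup>2 + (1/2) * (dist y1 q)\<^sup>2 - (1/4) * (dist y0 y1)\<^sup>2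
           \<ge> (dist q p)\<^sup>2"

text \<open>Finiteness of the expectation is automatic: the integrand is bounded by \<open>dist q z\<close>.\<close>

definition frechet_median :: "'w measure \<Rightarrow> ('w \<Rightarrow> 'a::metric_space) \<Rightarrow> 'a \<Rightarrow> bool" where
  "frechet_median M Y m \<longleftrightarrow>
     (\<forall>z. is_arg_min (\<lambda>q. \<integral>\<omega>. (dist (Y \<omega>) q - dist (Y \<omega>) z) \<partial>M) (\<lambda>q. True) m)"

definition empirical_frechet_median :: "nat \<Rightarrow> (nat \<Rightarrow> 'a::metric_space) \<Rightarrow> 'a \<Rightarrow> bool" where
  "empirical_frechet_median n y m \<longleftrightarrow>
     is_arg_min (\<lambda>q. \<Sum>j=1..n. dist (y j) q) (\<lambda>q. True) m"

text \<open>Restricting to \<^const>\<open>extensional\<close> functions makes the geodesic, which is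
  determined only on \<open>[0, d(q,p)]\<close>, unique as a total function.\<close>

definition geodesic :: "'a::metric_space \<Rightarrow> 'a \<Rightarrow> real \<Rightarrow> 'a" where
  "geodesic q p = (THE \<gamma>. \<gamma> \<in> extensional {0..dist q p} \<and> \<gamma> 0 = q \<and> \<gamma> (dist q p) = p \<and>
     (\<forall>s\<in>{0..dist q p}. \<forall>t\<in>{0..dist q p}. dist (\<gamma> s) (\<gamma> t) = \<bar>s - t\<bar>))"

definition bow_tie :: "'a::metric_space \<Rightarrow> 'a \<Rightarrow> real \<Rightarrow> 'a set" where
  "bow_tie q p w =
     (if q = p then (if w < 1 then {q} else UNIV)
      else {y. max ((vector_derivative (\<lambda>t. dist y (geodesic q p t)) (at_right 0))\<^sup>2)
                   ((vector_derivative (\<lambda>t. dist y (geodesic q p t)) (at_left (dist q p)))\<^sup>2)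
               \<ge> 1 - w\<^sup>2})"

end

theory Submission
  imports Defs
begin

text \<open>
  Write \<open>e = dist m m\<^sub>n\<close> for the error of the empirical median of \<open>n\<close> observations. There is no
  gradient and no entropy bound to work with in a general Hadamard space; the rate comes from convexity
  and from a stability argument.

  Convexity. Along the geodesic between \<open>q\<close> and \<open>p\<close> the distance to \<open>y\<close> is convex, and if \<open>y\<close>
  lies outside the bow tie between \<open>q\<close> and \<open>p\<close>, its slopes stay away from \<open>1\<close> and \<open>-1\<close>. Then the
  semi-parallelogram law gives a quadratic gain at the midpoint (\<open>midpt_gain\<close>). Taking
  expectations with one knot at \<open>m\<close>, the risk grows quadratically around \<open>m\<close>
  (\<open>median_variance_inequality\<close>). For the sample, cut \<open>1..n\<close> into blocks of length \<open>l\<close>. With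
  positive probability a block has, for all pairs of knots in the ball simultaneously, an observation in
  the ball outside the bow tie (\<open>pos_measure_block\<close>). By Hoeffding's inequality a fixed
  proportion of the blocks does so up to exponentially small probability
  (\<open>block_hits_concentration\<close>), and the empirical objective is strongly convex on the ball.

  Stability. Exchanging one observation changes the sum of distances by a function with Lipschitz
  constant \<open>2\<close>, so strong convexity with a constant of order \<open>n\<close> moves the median by
  only \<open>O(1/n)\<close> (\<open>median_replace_one\<close>). The excess risk of the empirical median is its loss on
  a fresh observation. By symmetry this is the loss on observation \<open>i\<close> of the median in which
  observation \<open>i\<close> has been exchanged with the fresh one, and that loss is, on average over \<open>i\<close>,
  at most \<open>O(1/n)\<close> above the loss of \<open>m\<close>
  (\<open>expected_excess_of_stable_median\<close>). Quadratic growth of the risk turns this into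
  \<open>O(1/n)\<close> for the second moment of \<open>e\<close>.

  Far away. All this needs the median to stay in the ball. More than two thirds of
  the observations within \<open>s\<close> of \<open>m\<close> force \<open>e \<le> 4 * s\<close> (\<open>median_breakdown\<close>). Hence a union bound
  gives \<open>P(e > 4 * s) \<le> (8 * P(d(Y,m) > s)) ^ \<lceil>n / 3\<rceil>\<close> (\<open>median_tail\<close>). At \<open>s = r\<close> the base is
  below \<open>8 / 27\<close>, and with the moment of order \<open>\<xi>\<close> the contribution of \<open>e > 4 * r\<close> to the second moment is
  exponentially small (\<open>second_moment_of_light_tails\<close>).

  The space need not be separable, so joint measurability of the distance and almost sure optimality
  of medians of exchanged samples have to be derived from the countable dense subset
  of the set that carries the law (locale \<open>separable_law\<close>).
\<close>

section \<open>Geodesics and bow ties in Hadamard spaces\<close>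

lemma borel_measurable_dist_const [measurable (raw)]:
  fixes c :: "'b::metric_space"
  assumes "f \<in> measurable M borel"
  shows "(\<lambda>x. dist (f x) c) \<in> borel_measurable M"
  using assms
  by (rule measurable_compose) (intro borel_measurable_continuous_onI continuous_intros)

lemma borel_measurable_const_dist [measurable (raw)]:
  fixes c :: "'b::metric_space"
  assumes "f \<in> measurable M borel"
  shows "(\<lambda>x. dist c (f x)) \<in> borel_measurable M"
  using borel_measurable_dist_const[OF assms, of c] by (simp add: dist_commute)

definition midpt :: "'a::hadamard_space \<Rightarrow> 'a \<Rightarrow> 'a" where
  "midpt x y = (SOME p. \<forall>q. (1/2) * (dist x q)\<^sup>2 + (1/2) * (dist y q)\<^sup>2 - (1/4) * (dist x y)\<^sup>2
     \<ge> (dist q p)\<^sup>2)"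

lemma semi_parallelogram:
  fixes x y z :: "'a::hadamard_space"
  shows "(dist z (midpt x y))\<^sup>2 \<le> (1/2) * (dist x z)\<^sup>2 + (1/2) * (dist y z)\<^sup>2 - (1/4) * (dist x y)\<^sup>2"
  using someI_ex[OF hadamard_midpoint[of x y]] unfolding midpt_def by blast

lemma dist_midpt:
  fixes x y :: "'a::hadamard_space"
  shows "dist x (midpt x y) = dist x y / 2" "dist y (midpt x y) = dist x y / 2"
proof -
  have "(dist x (midpt x y))\<^sup>2 \<le> (dist x y / 2)\<^sup>2"
    using semi_parallelogram[of x x y] by (simp add: dist_commute power_divide)
  then have 1: "dist x (midpt x y) \<le> dist x y / 2"
    by (rule power2_le_imp_le) simp
  have "(dist y (midpt x y))\<^sup>2 \<le> (dist x y / 2)\<^sup>2"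
    using semi_parallelogram[of y x y] by (simp add: dist_commute power_divide)
  then have 2: "dist y (midpt x y) \<le> dist x y / 2"
    by (rule power2_le_imp_le) simp
  have "dist x y \<le> dist x (midpt x y) + dist y (midpt x y)"
    by (rule dist_triangle2)
  with 1 2 show "dist x (midpt x y) = dist x y / 2" "dist y (midpt x y) = dist x y / 2"
    by auto
qed

text \<open>
Averages of squares bound the square of the average up to the variance, and the reverse triangle
inequality lets the term \<open>(dist x y)\<^sup>2 / 4\<close> of the semi-parallelogram law pay for that
variance. So the distance to a point is midpoint convex, not just its square.
\<close>

lemma dist_midpt_le:
  fixes x y z :: "'a::hadamard_space"
  shows "dist z (midpt x y) \<le> (dist z x + dist z y) / 2"
proof (rule power2_le_imp_le)
  have "\<bar>dist z x - dist z y\<bar> \<le> dist x y"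
    using dist_triangle[of z x y] dist_triangle[of z y x] by (simp add: dist_commute abs_le_iff)
  then have "(dist z x - dist z y)\<^sup>2 \<le> (dist x y)\<^sup>2"
    by (metis abs_ge_zero power2_abs power_mono)
  then show "(dist z (midpt x y))\<^sup>2 \<le> ((dist z x + dist z y) / 2)\<^sup>2"
    using semi_parallelogram[of z x y]
    by (simp add: dist_commute power2_eq_square algebra_simps)
qed simp

text \<open>
The midpoint of two different points of this kind would be strictly closer to both \<open>q\<close> and
\<open>p\<close> than the triangle inequality permits.
\<close>

lemma geodesic_point_unique:
  fixes q p x x' :: "'a::hadamard_space"
  assumes "dist q x \<le> t" "dist x p \<le> dist q p - t" "dist q x' \<le> t" "dist x' p \<le> dist q p - t"
  shows "x = x'"
proof (rule ccontr)
  assume "x \<noteq> x'"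
  then have d: "0 < (dist x x')\<^sup>2" by simp
  let ?z = "midpt x x'"
  have "(dist q ?z)\<^sup>2 \<le> (1/2) * t\<^sup>2 + (1/2) * t\<^sup>2 - (1/4) * (dist x x')\<^sup>2"
    using semi_parallelogram[of q x x'] power_mono[OF assms(1), of 2] power_mono[OF assms(3), of 2]
    by (simp add: dist_commute)
  with d have "(dist q ?z)\<^sup>2 < t\<^sup>2" by linarith
  moreover have "0 \<le> t" using assms(1) zero_le_dist order_trans by blast
  ultimately have 1: "dist q ?z < t" using power2_less_imp_less by blast
  have "(dist p ?z)\<^sup>2 \<le> (1/2) * (dist q p - t)\<^sup>2 + (1/2) * (dist q p - t)\<^sup>2 - (1/4) * (dist x x')\<^sup>2"
    using semi_parallelogram[of p x x'] power_mono[OF assms(2), of 2] power_mono[OF assms(4), of 2]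
    by (simp add: dist_commute)
  with d have "(dist p ?z)\<^sup>2 < (dist q p - t)\<^sup>2" by linarith
  moreover have "0 \<le> dist q p - t" using assms(2) zero_le_dist order_trans by blast
  ultimately have 2: "dist p ?z < dist q p - t" using power2_less_imp_less by blast
  from 1 2 dist_triangle2[of q p ?z] show False by linarith
qed

text \<open>
One step of interval halving: \<open>(a, b)\<close> is a segment of a geodesic from \<open>q\<close>
that straddles the point at distance \<open>t\<close>, and the step keeps the half that still does.
\<close>

fun bisect :: "'a::hadamard_space \<Rightarrow> real \<Rightarrow> 'a \<times> 'a \<Rightarrow> 'a \<times> 'a" where
  "bisect q t (a, b) = (if dist q (midpt a b) \<le> t then (midpt a b, b) else (a, midpt a b))"

text \<open>
Repeated halving with midpoints traps the wanted point; the left ends move by at most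
\<open>dist q p / 2 ^ (n + 1)\<close>, hence converge.
\<close>

lemma geodesic_point_exists:
  fixes q p :: "'a::hadamard_space"
  assumes t: "0 \<le> t" "t \<le> dist q p"
  shows "\<exists>x. dist q x \<le> t \<and> dist x p \<le> dist q p - t"
proof -
  define s where "s n = (bisect q t ^^ n) (q, p)" for n
  define a b where "a n = fst (s n)" and "b n = snd (s n)" for n
  have s_Suc: "s (Suc n) = bisect q t (a n, b n)" for n
    by (simp add: a_def b_def s_def)
  have step: "a (Suc n) = (if dist q (midpt (a n) (b n)) \<le> t then midpt (a n) (b n) else a n)"
    "b (Suc n) = (if dist q (midpt (a n) (b n)) \<le> t then b n else midpt (a n) (b n))" for n
    unfolding a_def[of "Suc n"] b_def[of "Suc n"] s_Suc by simp_all
  have inv: "dist q (a n) \<le> t \<and> t \<le> dist q (b n) \<and> dist (a n) (b n) = dist q p / 2 ^ n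
      \<and> dist q (a n) + dist (a n) (b n) + dist (b n) p \<le> dist q p" for n
  proof (induction n)
    case 0 then show ?case using t by (simp add: a_def b_def s_def)
  next
    case (Suc n)
    let ?z = "midpt (a n) (b n)"
    have "dist (a n) ?z = dist (a n) (b n) / 2" "dist (b n) ?z = dist (a n) (b n) / 2"
      by (rule dist_midpt)+
    moreover define h where "h = dist q p / 2 ^ Suc n"
    moreover have "dist (a n) (b n) = 2 * (dist q p / 2 ^ Suc n)" using Suc by simp
    ultimately have half: "dist (a n) ?z = h" "dist ?z (b n) = h" "dist (a n) (b n) = 2 * h"
      by (simp_all add: dist_commute[of ?z "b n"])
    have tri: "dist q ?z \<le> dist q (a n) + dist (a n) ?z" "dist ?z p \<le> dist ?z (b n) + dist (b n) p"
      by (rule dist_triangle)+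
    from Suc have IH: "dist q (a n) \<le> t" "t \<le> dist q (b n)"
      "dist q (a n) + dist (a n) (b n) + dist (b n) p \<le> dist q p" by blast+
    show ?case
    proof (cases "dist q ?z \<le> t")
      case True
      then have "a (Suc n) = ?z" "b (Suc n) = b n" by (simp_all add: step)
      moreover have "dist q ?z + dist ?z (b n) + dist (b n) p \<le> dist q p"
        using half tri IH by linarith
      ultimately show ?thesis using True IH half unfolding h_def by metis
    next
      case False
      then have "a (Suc n) = a n" "b (Suc n) = ?z" by (simp_all add: step)
      moreover have "dist q (a n) + dist (a n) ?z + dist ?z p \<le> dist q p"
        using half tri IH by linarith
      ultimately show ?thesis using False IH half unfolding h_def by (metis linear)
    qed
  qed
  have da: "dist (a n) (a (Suc n)) \<le> dist q p * (1/2) ^ Suc n" for n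
  proof -
    have "a (Suc n) = midpt (a n) (b n) \<or> a (Suc n) = a n"
      by (simp add: step(1)[of n])
    moreover have "dist (a n) (midpt (a n) (b n)) = dist q p * (1/2) ^ Suc n"
      using inv[of n] dist_midpt(1)[of "a n" "b n"] by (simp add: power_divide)
    ultimately show ?thesis by (elim disjE) simp_all
  qed
  have "Cauchy a"
  proof (rule metric_CauchyI)
    fix e :: real assume "0 < e"
    have tel: "dist (a n) (a (n + k)) \<le> 2 * dist q p * (1/2) ^ n" for n k
    proof -
      have "dist (a n) (a (n + k)) \<le> (\<Sum>i<k. dist q p * (1/2) ^ Suc (n + i))"
      proof (induction k)
        case (Suc k)
        have "dist (a n) (a (n + Suc k)) \<le> dist (a n) (a (n + k)) + dist (a (n + k)) (a (Suc (n + k)))"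
          using dist_triangle[of "a n" "a (n + Suc k)" "a (n + k)"] by simp
        also have "\<dots> \<le> (\<Sum>i<k. dist q p * (1/2) ^ Suc (n + i)) + dist q p * (1/2) ^ Suc (n + k)"
          using Suc da by (intro add_mono) auto
        finally show ?case by simp
      qed simp
      also have "\<dots> = dist q p * (1/2) ^ n * (\<Sum>i<k. (1/2) ^ Suc i)"
        by (simp add: sum_distrib_left power_add algebra_simps)
      also have "(\<Sum>i<k. (1/2::real) ^ Suc i) = 1 - (1/2) ^ k"
        by (induction k) simp_all
      also have "dist q p * (1/2) ^ n * (1 - (1/2) ^ k) \<le> dist q p * (1/2) ^ n * 1"
        by (intro mult_left_mono) simp_all
      also have "dist q p * (1/2) ^ n * 1 \<le> 2 * dist q p * (1/2) ^ n" by simp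
      finally show ?thesis .
    qed
    have "(\<lambda>n. 2 * dist q p * (1/2) ^ n) \<longlonglongrightarrow> 2 * dist q p * 0"
      by (intro tendsto_mult tendsto_const LIMSEQ_power_zero) simp
    then have "\<forall>\<^sub>F n in sequentially. 2 * dist q p * (1/2) ^ n < e / 2"
      using \<open>0 < e\<close> by (intro order_tendstoD(2)[of _ 0]) auto
    then obtain N where N: "2 * dist q p * (1/2) ^ N < e / 2"
      by (auto simp: eventually_sequentially)
    have "dist (a i) (a j) < e" if "i \<ge> N" "j \<ge> N" for i j
    proof -
      have "dist (a N) (a i) < e/2" "dist (a N) (a j) < e/2"
        using tel[of N "i - N"] tel[of N "j - N"] that N by auto
      then show ?thesis using dist_triangle_half_r by blast
    qed
    then show "\<exists>M. \<forall>m\<ge>M. \<forall>n\<ge>M. dist (a m) (a n) < e" by blast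
  qed
  then obtain x where x: "a \<longlonglongrightarrow> x"
    using Cauchy_convergent[OF \<open>Cauchy a\<close>] unfolding convergent_def by blast
  have "dist q x \<le> t"
    by (rule LIMSEQ_le_const2[OF tendsto_dist[OF tendsto_const x]]) (use inv in auto)
  moreover have "dist x p \<le> dist q p - t"
  proof (rule LIMSEQ_le[OF tendsto_dist[OF x tendsto_const]])
    show "(\<lambda>n. dist q p - t + dist q p * (1/2) ^ n) \<longlonglongrightarrow> dist q p - t"
      by (rule tendsto_eq_intros LIMSEQ_power_zero | simp)+
    have "dist (a n) p \<le> dist q p - t + dist q p * (1/2) ^ n" for n
    proof -
      have "t \<le> dist q (a n) + dist (a n) (b n)"
        using inv[of n] dist_triangle[of q "b n" "a n"] by linarith
      moreover have "dist (a n) p \<le> dist (a n) (b n) + dist (b n) p" by (rule dist_triangle)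
      moreover have "dist (a n) (b n) = dist q p * (1/2) ^ n"
        using inv[of n] by (simp add: power_divide)
      ultimately show ?thesis using inv[of n] by linarith
    qed
    then show "\<exists>N. \<forall>n\<ge>N. dist (a n) p \<le> dist q p - t + dist q p * (1/2) ^ n" by blast
  qed
  ultimately show ?thesis by blast
qed

text \<open>
The definition of \<^const>\<open>geodesic\<close> by \<open>THE\<close> is meaningful: a geodesic must pick,
at each parameter, the unique point with the prescribed distances to both ends, and this choice is
an isometry because the point at distance \<open>s\<close> on the way to \<open>\<gamma> t\<close> is again \<open>\<gamma> s\<close> by uniqueness.
\<close>

lemma geodesic:
  fixes q p :: "'a::hadamard_space"
  shows "geodesic q p 0 = q" "geodesic q p (dist q p) = p"
    and "s \<in> {0..dist q p} \<Longrightarrow> t \<in> {0..dist q p} \<Longrightarrow>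
           dist (geodesic q p s) (geodesic q p t) = \<bar>s - t\<bar>"
proof -
  let ?D = "{0..dist q p}"
  let ?P = "\<lambda>\<gamma>. \<gamma> \<in> extensional ?D \<and> \<gamma> 0 = q \<and> \<gamma> (dist q p) = p \<and>
     (\<forall>s\<in>?D. \<forall>t\<in>?D. dist (\<gamma> s) (\<gamma> t) = \<bar>s - t\<bar>)"
  define \<gamma> where "\<gamma> = (\<lambda>t\<in>?D. SOME x. dist q x \<le> t \<and> dist x p \<le> dist q p - t)"
  have \<gamma>: "dist q (\<gamma> t) \<le> t" "dist (\<gamma> t) p \<le> dist q p - t" if "t \<in> ?D" for t
    using someI_ex[OF geodesic_point_exists[of t q p]] that by (auto simp: \<gamma>_def)
  have eqI: "x = \<gamma> t" if "t \<in> ?D" "dist q x \<le> t" "dist x p \<le> dist q p - t" for x t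
    using geodesic_point_unique that \<gamma> by blast
  have iso: "dist (\<gamma> s) (\<gamma> t) = t - s" if st: "s \<in> ?D" "t \<in> ?D" "s \<le> t" for s t
  proof -
    have qt: "dist q (\<gamma> t) = t"
      using \<gamma>[OF st(2)] dist_triangle[of q p "\<gamma> t"] by linarith
    obtain x where x: "dist q x \<le> s" "dist x (\<gamma> t) \<le> dist q (\<gamma> t) - s"
      using geodesic_point_exists[of s q "\<gamma> t"] st qt by auto
    have "dist x p \<le> dist q p - s"
      using dist_triangle[of x p "\<gamma> t"] x \<gamma>[OF st(2)] qt by linarith
    then have "x = \<gamma> s" using eqI[OF st(1)] x by blast
    moreover have "t \<le> dist q x + dist x (\<gamma> t)" using dist_triangle qt by metis
    ultimately show ?thesis using x qt by auto
  qed
  have iso': "dist (\<gamma> s) (\<gamma> t) = \<bar>s - t\<bar>" if "s \<in> ?D" "t \<in> ?D" for s t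
    using iso[OF that] iso[OF that(2,1)] by (cases "s \<le> t") (auto simp: dist_commute)
  have P: "?P \<gamma>"
    using iso' eqI[of 0 q] eqI[of "dist q p" p] by (auto simp: \<gamma>_def)
  moreover have "\<gamma>' = \<gamma>" if "?P \<gamma>'" for \<gamma>'
  proof (rule extensionalityI[of _ ?D])
    fix t assume t: "t \<in> ?D"
    have e: "\<gamma>' 0 = q" "\<gamma>' (dist q p) = p"
      and i: "\<And>s t. s \<in> ?D \<Longrightarrow> t \<in> ?D \<Longrightarrow> dist (\<gamma>' s) (\<gamma>' t) = \<bar>s - t\<bar>"
      using that by blast+
    have "dist q (\<gamma>' t) = t" using i[of 0 t] t e by simp
    moreover have "dist (\<gamma>' t) p = dist q p - t" using i[of t "dist q p"] t e by simp
    ultimately show "\<gamma>' t = \<gamma> t" using t by (intro eqI) simp_all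
  qed (use that P in auto)
  ultimately have "?P (geodesic q p)"
    unfolding geodesic_def by (rule theI)
  then show "geodesic q p 0 = q" "geodesic q p (dist q p) = p"
    "s \<in> ?D \<Longrightarrow> t \<in> ?D \<Longrightarrow> dist (geodesic q p s) (geodesic q p t) = \<bar>s - t\<bar>"
    by blast+
qed

lemma midpt_geodesic:
  fixes q p :: "'a::hadamard_space"
  assumes "s \<in> {0..dist q p}" "t \<in> {0..dist q p}"
  shows "midpt (geodesic q p s) (geodesic q p t) = geodesic q p ((s + t) / 2)"
proof (rule geodesic_point_unique)
  let ?x = "geodesic q p s" and ?y = "geodesic q p t" and ?u = "(s + t) / 2"
  let ?z = "midpt ?x ?y"
  have u: "?u \<in> {0..dist q p}" using assms by auto
  have fromq: "dist q (geodesic q p v) = v" "dist (geodesic q p v) p = dist q p - v"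
    if "v \<in> {0..dist q p}" for v
    using geodesic(3)[of 0 q p v] geodesic(3)[of v q p "dist q p"] that by (auto simp: geodesic(1,2))
  show "dist q (geodesic q p ?u) \<le> ?u" "dist (geodesic q p ?u) p \<le> dist q p - ?u"
    using fromq[OF u] by auto
  have z: "dist ?x ?z = \<bar>s - t\<bar> / 2" "dist ?y ?z = \<bar>s - t\<bar> / 2"
    using dist_midpt(1)[of ?x ?y] dist_midpt(2)[of ?y ?x] geodesic(3)[OF assms] by auto
  show "dist q ?z \<le> ?u"
    using dist_triangle[of q ?z ?x] dist_triangle[of q ?z ?y] fromq[OF assms(1)] fromq[OF assms(2)] z
    by (cases "s \<le> t") (simp_all add: field_simps)
  show "dist ?z p \<le> dist q p - ?u"
    using dist_triangle3[of ?z p ?x] dist_triangle3[of ?z p ?y] fromq[OF assms(1)] fromq[OF assms(2)] z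
    by (cases "s \<le> t") (simp_all add: field_simps)
qed

text \<open>
Subtract the chord and look at a maximiser.
\<close>

lemma midpoint_convex_imp_convex_on:
  fixes f :: "real \<Rightarrow> real"
  assumes cont: "continuous_on {a..b} f"
    and mid: "\<And>s t. s \<in> {a..b} \<Longrightarrow> t \<in> {a..b} \<Longrightarrow> f ((s + t) / 2) \<le> (f s + f t) / 2"
  shows "convex_on {a..b} f"
proof -
  have "f (x + u * (y - x)) \<le> f x + u * (f y - f x)"
    if xy: "x \<in> {a..b}" "y \<in> {a..b}" "x < y" and u: "0 \<le> u" "u \<le> 1" for x y u
  proof -
    define c where "c = (f y - f x) / (y - x)"
    define h where "h s = (s - x) * c" for s
    define g where "g s = f s - f x - h s" for s
    have "continuous_on {x..y} g"
      unfolding g_def h_def using xy by (intro continuous_intros continuous_on_subset[OF cont]) auto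
    then obtain t where t: "t \<in> {x..y}" and max: "\<And>s. s \<in> {x..y} \<Longrightarrow> g s \<le> g t"
      using continuous_attains_sup[of "{x..y}" g] xy by auto
    have g0: "g x = 0" "g y = 0" using xy by (auto simp: g_def h_def c_def)
    have gmid: "g ((s + t) / 2) \<le> (g s + g t) / 2" if "s \<in> {x..y}" "t \<in> {x..y}" for s t
    proof -
      define u where "u = (s + t) / 2"
      have "h u = (h s + h t) / 2"
        by (simp add: u_def h_def algebra_simps add_divide_distrib)
      moreover have "f u \<le> (f s + f t) / 2"
        unfolding u_def using mid[of s t] that xy by simp
      ultimately have "g u \<le> (g s + g t) / 2" unfolding g_def by (simp add: field_simps)
      then show ?thesis by (simp add: u_def)
    qed
    \<comment> \<open>reflect the nearer endpoint at a maximiser \<open>t\<close>: the midpoint inequality forces \<open>g t \<le> 0\<close>\<close>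
    have "g t \<le> 0"
    proof (cases "2 * t \<le> x + y")
      case True
      then show ?thesis using gmid[of x "2 * t - x"] max[of "2 * t - x"] t g0 xy by auto
    next
      case False
      then show ?thesis using gmid[of y "2 * t - y"] max[of "2 * t - y"] t g0 xy by auto
    qed
    moreover have "u * (y - x) \<le> 1 * (y - x)" "0 \<le> u * (y - x)"
      using xy u by (intro mult_right_mono mult_nonneg_nonneg; simp)+
    then have "x + u * (y - x) \<in> {x..y}" by simp
    ultimately have "g (x + u * (y - x)) \<le> 0" using max by fastforce
    then show ?thesis using xy by (simp add: g_def h_def c_def)
  qed
  note * = this
  show ?thesis
  proof (rule convex_onI)
    fix u x y :: real assume u: "0 < u" "u < 1" and xy: "x \<in> {a..b}" "y \<in> {a..b}"
    consider "x < y" | "x = y" | "y < x" by linarith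
    then show "f ((1 - u) *\<^sub>R x + u *\<^sub>R y) \<le> (1 - u) * f x + u * f y"
    proof cases
      case 1 then show ?thesis using *[of x y u] xy u by (simp add: algebra_simps)
    next
      case 2 then show ?thesis by (simp add: algebra_simps)
    next
      case 3 then show ?thesis using *[of y x "1 - u"] xy u by (simp add: algebra_simps)
    qed
  qed simp
qed

lemma convex_on_dist_geodesic:
  fixes q p y :: "'a::hadamard_space"
  shows "convex_on {0..dist q p} (\<lambda>t. dist y (geodesic q p t))"
proof (rule midpoint_convex_imp_convex_on)
  have "1-lipschitz_on {0..dist q p} (geodesic q p)"
    by (intro lipschitz_onI) (auto simp: geodesic(3) dist_real_def)
  then show "continuous_on {0..dist q p} (\<lambda>t. dist y (geodesic q p t))"
    by (intro continuous_intros lipschitz_on_continuous_on)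
next
  fix s t assume "s \<in> {0..dist q p}" "t \<in> {0..dist q p}"
  then show "dist y (geodesic q p ((s + t) / 2)) \<le> (dist y (geodesic q p s) + dist y (geodesic q p t)) / 2"
    using dist_midpt_le[of y "geodesic q p s" "geodesic q p t"] by (simp add: midpt_geodesic)
qed

text \<open>
The difference quotients of a convex function are monotone, so a lower bound on them is all that
is needed for their limit at the left end to exist; the limit is at most every quotient, in
particular the one of the whole interval.
\<close>

lemma convex_right_derivative_exists:
  fixes f :: "real \<Rightarrow> real"
  assumes f: "convex_on {a..b} f" and "a < b"
    and low: "\<And>t. t \<in> {a<..b} \<Longrightarrow> B \<le> (f t - f a) / (t - a)"
  shows "\<exists>L. (f has_vector_derivative L) (at_right a) \<and> L * (b - a) \<le> f b - f a"
proof -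
  let ?s = "\<lambda>t. (f t - f a) / (t - a)"
  define L where "L = (INF t\<in>{a<..b}. ?s t)"
  have bdd: "bdd_below (?s ` {a<..b})" using low by (auto intro!: bdd_belowI[of _ B])
  have mono: "?s t \<le> ?s u" if "a < t" "t \<le> u" "u \<le> b" for t u
  proof (cases "t = u")
    case False
    have "(f a - f t) / (a - t) \<le> (f a - f u) / (a - u)"
      using convex_on_slope_le(1)[OF f, of a u t] that \<open>a < b\<close> False by auto
    then show ?thesis by (metis minus_diff_eq minus_divide_divide)
  qed simp
  have lim: "(?s \<longlongrightarrow> L) (at_right a)"
  proof (rule order_tendstoI)
    fix c assume "c < L"
    have "\<forall>\<^sub>F t in at_right a. t \<in> {a<..b}"
      using \<open>a < b\<close> by (auto simp: eventually_at_right intro!: exI[of _ b])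
    then show "\<forall>\<^sub>F t in at_right a. c < ?s t"
      by eventually_elim (use \<open>c < L\<close> cINF_lower[OF bdd] in \<open>auto simp: L_def intro: less_le_trans\<close>)
  next
    fix c assume "L < c"
    then obtain u where u: "u \<in> {a<..b}" "?s u < c"
      using cINF_less_iff[of "{a<..b}" ?s c] bdd \<open>a < b\<close> by (auto simp: L_def)
    then have "\<forall>\<^sub>F t in at_right a. a < t \<and> t \<le> u"
      by (auto simp: eventually_at_right intro!: exI[of _ u])
    then show "\<forall>\<^sub>F t in at_right a. ?s t < c"
    proof eventually_elim
      case (elim t)
      then show ?case using u(2) mono[of t u] u(1) by simp
    qed
  qed
  then have "(f has_vector_derivative L) (at_right a)"
    by (simp add: has_real_derivative_iff_has_vector_derivative[symmetric] has_field_derivative_iff)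
  moreover have "L \<le> ?s b" unfolding L_def using \<open>a < b\<close> by (intro cINF_lower[OF bdd]) auto
  then have "L * (b - a) \<le> f b - f a" using \<open>a < b\<close> by (simp add: field_simps)
  ultimately show ?thesis by blast
qed

lemma convex_left_derivative_exists:
  fixes f :: "real \<Rightarrow> real"
  assumes f: "convex_on {a..b} f" and "a < b"
    and up: "\<And>t. t \<in> {a..<b} \<Longrightarrow> (f b - f t) / (b - t) \<le> B"
  shows "\<exists>L. (f has_vector_derivative L) (at_left b) \<and> f b - f a \<le> L * (b - a)"
proof -
  have "convex_on {-b..-a} (\<lambda>t. f (- t))"
  proof (rule convex_onI)
    fix u x y :: real assume "0 < u" "u < 1" "x \<in> {-b..-a}" "y \<in> {-b..-a}"
    then show "f (- ((1 - u) *\<^sub>R x + u *\<^sub>R y)) \<le> (1 - u) * f (- x) + u * f (- y)"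
      using convex_onD[OF f, of u "-x" "-y"] by (simp add: algebra_simps)
  qed simp
  moreover have "- B \<le> (f (- t) - f (- (- b))) / (t - (- b))" if "t \<in> {-b<..-a}" for t
    using up[of "- t"] that by (simp add: field_simps)
  ultimately obtain L where L: "((\<lambda>t. f (- t)) has_vector_derivative L) (at_right (- b))"
    "L * (b - a) \<le> f a - f b"
    using convex_right_derivative_exists[of "- b" "- a" "\<lambda>t. f (- t)" "- B"] \<open>a < b\<close> by auto
  from L(1) have "((\<lambda>t. (f (- t) - f b) / (b + t)) \<longlongrightarrow> L) (at_right (- b))"
    by (simp add: has_real_derivative_iff_has_vector_derivative[symmetric] has_field_derivative_iff
        add.commute)
  then have "((\<lambda>t. - ((f t - f b) / (b - t))) \<longlongrightarrow> - L) (at_left b)"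
    by (intro tendsto_minus) (simp add: at_left_minus[of b] filterlim_filtermap)
  moreover have "- ((f t - f b) / (b - t)) = (f t - f b) / (t - b)" for t
    by (metis minus_diff_eq minus_divide_right)
  ultimately have "(f has_vector_derivative - L) (at_left b)"
    by (simp add: has_real_derivative_iff_has_vector_derivative[symmetric] has_field_derivative_iff)
  with L(2) show ?thesis by (intro exI[of _ "- L"]) auto
qed

text \<open>
\<^const>\<open>vector_derivative\<close> is a choice operator, so \<^const>\<open>bow_tie\<close> carries information only
because the one-sided derivatives exist. The two inequalities say that the mean slope of the
distance along the geodesic lies between them.
\<close>

lemma dist_geodesic_one_sided_derivatives:
  fixes q p y :: "'a::hadamard_space"
  assumes "q \<noteq> p"
  defines "f \<equiv> \<lambda>t. dist y (geodesic q p t)"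
  shows "(f has_vector_derivative vector_derivative f (at_right 0)) (at_right 0)" (is ?R)
    and "(f has_vector_derivative vector_derivative f (at_left (dist q p))) (at_left (dist q p))" (is ?L)
    and "vector_derivative f (at_right 0) * dist q p \<le> dist y p - dist y q" (is ?r)
    and "dist y p - dist y q \<le> vector_derivative f (at_left (dist q p)) * dist q p" (is ?l)
proof -
  let ?d = "dist q p"
  have d: "0 < ?d" using assms by simp
  have conv: "convex_on {0..?d} f" unfolding f_def by (rule convex_on_dist_geodesic)
  have f: "f 0 = dist y q" "f ?d = dist y p" by (auto simp: f_def geodesic)
  have lip: "\<bar>f s - f t\<bar> \<le> \<bar>s - t\<bar>" if "s \<in> {0..?d}" "t \<in> {0..?d}" for s t
    using geodesic(3)[OF that] dist_triangle[of y "geodesic q p s" "geodesic q p t"]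
      dist_triangle[of y "geodesic q p t" "geodesic q p s"]
    by (simp add: f_def dist_commute abs_le_iff)
  have "- 1 \<le> (f t - f 0) / (t - 0)" if "t \<in> {0<..?d}" for t
    using lip[of t 0] that d by (simp add: field_simps abs_le_iff)
  from convex_right_derivative_exists[OF conv d this] obtain L
    where L: "(f has_vector_derivative L) (at_right 0)" "L * (?d - 0) \<le> f ?d - f 0" by blast
  have "vector_derivative f (at_right 0) = L"
    using L(1) by (intro vector_derivative_within) auto
  with L f show ?R ?r by auto
  have "(f ?d - f t) / (?d - t) \<le> 1" if "t \<in> {0..<?d}" for t
    using lip[of ?d t] that d by (simp add: field_simps abs_le_iff)
  from convex_left_derivative_exists[OF conv d this] obtain L
    where L: "(f has_vector_derivative L) (at_left ?d)" "f ?d - f 0 \<le> L * (?d - 0)" by blast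
  have "vector_derivative f (at_left ?d) = L"
    using L(1) by (intro vector_derivative_within) auto
  with L f show ?L ?l by auto
qed

text \<open>
Outside a bow tie the distance is uniformly convex. Write \<open>a\<close>, \<open>c\<close>, \<open>b\<close> for the
distances of \<open>y\<close> to the ends and to the midpoint, and \<open>d = dist q p\<close>. The semi-parallelogram
law reads \<open>2 * (a\<^sup>2 + c\<^sup>2) - 4 * b\<^sup>2 \<ge> d\<^sup>2\<close>; the mean slope \<open>(c - a) / d\<close> is caught between the
one-sided derivatives, so \<open>(c - a)\<^sup>2 \<le> (1 - w\<^sup>2) * d\<^sup>2\<close>. Together
\<open>(a + c)\<^sup>2 - (2 * b)\<^sup>2 \<ge> w\<^sup>2 * d\<^sup>2\<close>, and factoring the left side linearises this.
\<close>

lemma midpt_gain: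
  fixes q p y :: "'a::hadamard_space"
  assumes "q \<noteq> p" "y \<notin> bow_tie q p w" "dist y q \<le> B" "dist y p \<le> B"
  shows "w\<^sup>2 * (dist q p)\<^sup>2 / (4 * B) \<le> dist y q + dist y p - 2 * dist y (midpt q p)"
proof -
  define f where "f = (\<lambda>t. dist y (geodesic q p t))"
  define L1 where "L1 = vector_derivative f (at_right 0)"
  define L2 where "L2 = vector_derivative f (at_left (dist q p))"
  define a b c d where "a = dist y q" and "b = dist y (midpt q p)" and "c = dist y p" and "d = dist q p"
  have d: "0 < d" using assms by (simp add: d_def)
  have w: "L1\<^sup>2 < 1 - w\<^sup>2" "L2\<^sup>2 < 1 - w\<^sup>2"
    using assms by (auto simp: bow_tie_def L1_def L2_def f_def)
  have sl: "L1 * d \<le> c - a" "c - a \<le> L2 * d"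
    using dist_geodesic_one_sided_derivatives(3,4)[OF assms(1), of y]
    by (auto simp: L1_def L2_def f_def a_def c_def d_def)
  have "((c - a) / d)\<^sup>2 \<le> 1 - w\<^sup>2"
  proof (cases "c \<le> a")
    case True
    with d have "L1 \<le> (c - a) / d" "(c - a) / d \<le> 0" using sl by (auto simp: field_simps)
    then have "((c - a) / d)\<^sup>2 \<le> L1\<^sup>2" by (metis abs_le_square_iff abs_of_nonpos neg_le_iff_le order_trans)
    then show ?thesis using w by simp
  next
    case False
    with d have "(c - a) / d \<le> L2" "0 \<le> (c - a) / d" using sl by (auto simp: field_simps)
    then have "((c - a) / d)\<^sup>2 \<le> L2\<^sup>2" by (simp add: power_mono)
    then show ?thesis using w by simp
  qed
  then have "(c - a)\<^sup>2 \<le> (1 - w\<^sup>2) * d\<^sup>2" using d by (simp add: power_divide field_simps)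
  moreover have "b\<^sup>2 \<le> (1/2) * a\<^sup>2 + (1/2) * c\<^sup>2 - (1/4) * d\<^sup>2"
    using semi_parallelogram[of y q p] by (simp add: a_def b_def c_def d_def dist_commute)
  ultimately have "w\<^sup>2 * d\<^sup>2 \<le> (a + c - 2 * b) * (a + c + 2 * b)"
    by (simp add: power2_eq_square algebra_simps)
  also have "\<dots> \<le> (a + c - 2 * b) * (4 * B)"
    using dist_midpt_le[of y q p] assms(3,4)
    by (intro mult_left_mono) (auto simp: a_def b_def c_def)
  finally have "w\<^sup>2 * d\<^sup>2 \<le> (a + c - 2 * b) * (4 * B)" .
  moreover have "0 < B"
    using d[unfolded d_def] assms(3,4) dist_triangle3[of q p y] by linarith
  ultimately show ?thesis
    by (simp add: a_def b_def c_def d_def field_simps)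
qed

text \<open>
The one-sided derivatives are limits of difference quotients along a fixed sequence, and each
quotient is continuous in \<open>y\<close>.
\<close>

lemma bow_tie_borel:
  fixes q p :: "'a::hadamard_space"
  assumes "q \<noteq> p"
  shows "bow_tie q p w \<in> sets borel"
proof -
  let ?d = "dist q p"
  have d: "0 < ?d" using assms by simp
  define f where "f = (\<lambda>y t. dist y (geodesic q p t))"
  define L1 where "L1 y = vector_derivative (f y) (at_right 0)" for y
  define L2 where "L2 y = vector_derivative (f y) (at_left ?d)" for y
  have seq: "(\<lambda>k. ?d / real (Suc k)) \<longlonglongrightarrow> 0"
    using LIMSEQ_inverse_real_of_nat tendsto_mult_right_zero by (fastforce simp: divide_inverse)
  have "filterlim (\<lambda>k. ?d / real (Suc k)) (at_right 0) sequentially"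
    using seq d by (auto simp: filterlim_at)
  moreover have "((\<lambda>t. (f y t - f y 0) / (t - 0)) \<longlongrightarrow> L1 y) (at_right 0)" for y
    using dist_geodesic_one_sided_derivatives(1)[OF assms, of y]
    by (simp add: L1_def f_def has_real_derivative_iff_has_vector_derivative[symmetric]
        has_field_derivative_iff)
  ultimately have lim1: "(\<lambda>k. (f y (?d / real (Suc k)) - f y 0) / (?d / real (Suc k) - 0)) \<longlonglongrightarrow> L1 y" for y
    by (rule filterlim_compose[rotated])
  have "filterlim (\<lambda>k. ?d - ?d / real (Suc k)) (at_left ?d) sequentially"
    using tendsto_diff[OF tendsto_const seq, of ?d] d by (auto simp: filterlim_at)
  moreover have "((\<lambda>t. (f y t - f y ?d) / (t - ?d)) \<longlongrightarrow> L2 y) (at_left ?d)" for y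
    using dist_geodesic_one_sided_derivatives(2)[OF assms, of y]
    by (simp add: L2_def f_def has_real_derivative_iff_has_vector_derivative[symmetric]
        has_field_derivative_iff)
  ultimately have lim2: "(\<lambda>k. (f y (?d - ?d / real (Suc k)) - f y ?d) / (?d - ?d / real (Suc k) - ?d)) \<longlonglongrightarrow> L2 y" for y
    by (rule filterlim_compose[rotated])
  have "L1 \<in> borel_measurable borel"
    by (rule borel_measurable_LIMSEQ_real[OF lim1]) (simp add: f_def)
  moreover have "L2 \<in> borel_measurable borel"
    by (rule borel_measurable_LIMSEQ_real[OF lim2]) (simp add: f_def)
  ultimately have "{y \<in> space borel. max ((L1 y)\<^sup>2) ((L2 y)\<^sup>2) \<ge> 1 - w\<^sup>2} \<in> sets borel"
    by measurable
  then show ?thesis using assms by (simp add: bow_tie_def L1_def L2_def f_def)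
qed

section \<open>Robustness and stability of medians\<close>

lemma empirical_frechet_median_iff:
  "empirical_frechet_median n y x \<longleftrightarrow> (\<forall>q. (\<Sum>j=1..n. dist (y j) x) \<le> (\<Sum>j=1..n. dist (y j) q))"
  by (simp add: empirical_frechet_median_def is_arg_min_linorder)

text \<open>
Moving from \<open>m\<close> to \<open>x\<close> costs at least \<open>d - 2 * s\<close> at each of the more than two thirds near
observations and saves at most \<open>d\<close> at each of the others, where \<open>d = dist m x\<close>. For
\<open>d > 4 * s\<close> the cost exceeds \<open>d / 2\<close> per near observation and the balance is strictly positive.
\<close>

lemma median_breakdown:
  fixes x m :: "'a::metric_space"
  assumes med: "empirical_frechet_median n y x"
    and few: "3 * card {j\<in>{1..n}. dist (y j) m > s} < n"
  shows "dist m x \<le> 4 * s"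
proof (rule ccontr)
  assume "\<not> dist m x \<le> 4 * s"
  define d where "d = dist m x"
  have d: "4 * s < d" using \<open>\<not> dist m x \<le> 4 * s\<close> by (simp add: d_def)
  define F where "F = {j\<in>{1..n}. dist (y j) m > s}"
  define N where "N = {j\<in>{1..n}. \<not> dist (y j) m > s}"
  have fin: "finite F" "finite N" and disj: "F \<inter> N = {}" and un: "F \<union> N = {1..n}"
    by (auto simp: F_def N_def)
  have "card F + card N = n"
    using card_Un_disjoint[OF fin disj] un by simp
  with few have cards: "2 * card F < card N" by (simp add: F_def)
  then obtain j where "j \<in> N" by fastforce
  then have "dist (y j) m \<le> s" by (simp add: N_def)
  then have "0 \<le> s" using zero_le_dist order_trans by blast
  have near: "d - 2 * s \<le> dist (y j) x - dist (y j) m" if "j \<in> N" for j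
    using that dist_triangle3[of m x "y j"] by (auto simp: N_def d_def)
  have far: "- d \<le> dist (y j) x - dist (y j) m" for j
    using dist_triangle2[of "y j" m x] by (simp add: d_def)
  have "real (card N) * (d - 2 * s) - real (card F) * d
      = (\<Sum>j\<in>N. d - 2 * s) + (\<Sum>j\<in>F. - d)" by simp
  also have "\<dots> \<le> (\<Sum>j\<in>N. dist (y j) x - dist (y j) m) + (\<Sum>j\<in>F. dist (y j) x - dist (y j) m)"
    using near far by (intro add_mono sum_mono)
  also have "\<dots> = (\<Sum>j\<in>{1..n}. dist (y j) x - dist (y j) m)"
    unfolding un[symmetric] by (subst sum.union_disjoint[OF fin disj]) simp
  also have "\<dots> \<le> 0"
    using med by (simp add: empirical_frechet_median_iff sum_subtractf)
  finally have "real (card N) * (d - 2 * s) \<le> real (card F) * d" by simp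
  moreover have "real (card F) * d \<le> (real (card N) / 2) * d"
    using cards d \<open>0 \<le> s\<close> by (intro mult_right_mono) auto
  moreover have "real (card N) * (d / 2) < real (card N) * (d - 2 * s)"
    using cards d by (intro mult_strict_left_mono) auto
  ultimately show False by simp
qed

text \<open>
Let \<open>F\<close> be the sum of distances to the \<open>y j\<close>. By \<open>midpt_gain\<close>, \<open>F\<close> gains at least
\<open>c * w\<^sup>2 * d\<^sup>2 / (8 * R)\<close> in convexity between \<open>x\<close> and \<open>x'\<close>, and \<open>x\<close> is a minimiser, so
\<open>F x' - F x\<close> is at least this much. But \<open>x'\<close> minimises a sum that differs from \<open>F\<close> in one
summand, so \<open>F x' - F x \<le> 2 * d\<close>. A quadratic bounded by a linear term bounds \<open>d\<close>.
\<close>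

lemma median_replace_one:
  fixes x x' m :: "'a::hadamard_space"
  assumes med: "empirical_frechet_median n y x" "empirical_frechet_median n y' x'"
    and i: "i \<in> {1..n}" and y': "\<And>j. j \<in> {1..n} \<Longrightarrow> j \<noteq> i \<Longrightarrow> y' j = y j"
    and near: "dist m x \<le> R" "dist m x' \<le> R" and "0 < R"
    and c: "0 < c" "0 < w"
    and many: "x \<noteq> x' \<Longrightarrow> c \<le> (\<Sum>j=1..n. of_bool (y j \<notin> bow_tie x x' w \<and> dist (y j) m \<le> R))"
  shows "dist x x' \<le> 16 * R / (c * w\<^sup>2)"
proof (cases "x = x'")
  case True then show ?thesis using \<open>0 < R\<close> c by simp
next
  case False
  let ?z = "midpt x x'" and ?d = "dist x x'"
  let ?good = "\<lambda>j. y j \<notin> bow_tie x x' w \<and> dist (y j) m \<le> R"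
  have gain: "of_bool (?good j) * (w\<^sup>2 * ?d\<^sup>2 / (8 * R)) \<le> dist (y j) x + dist (y j) x' - 2 * dist (y j) ?z" for j
  proof (cases "?good j")
    case True
    then have "dist (y j) x \<le> 2 * R" "dist (y j) x' \<le> 2 * R"
      using near dist_triangle[of "y j" x m] dist_triangle[of "y j" x' m] by auto
    then show ?thesis using midpt_gain[OF False, of "y j" w "2 * R"] True by simp
  next
    case False
    then have *: "of_bool (?good j) = (0::real)" by simp
    show ?thesis unfolding * mult_zero_left using dist_midpt_le[of "y j" x x'] by simp
  qed
  have "c * (w\<^sup>2 * ?d\<^sup>2 / (8 * R)) \<le> (\<Sum>j=1..n. of_bool (?good j)) * (w\<^sup>2 * ?d\<^sup>2 / (8 * R))"
    using many[OF False] \<open>0 < R\<close> by (intro mult_right_mono) auto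
  also have "\<dots> \<le> (\<Sum>j=1..n. dist (y j) x + dist (y j) x' - 2 * dist (y j) ?z)"
    unfolding sum_distrib_right by (intro sum_mono gain)
  also have "\<dots> = (\<Sum>j=1..n. dist (y j) x) + (\<Sum>j=1..n. dist (y j) x') - 2 * (\<Sum>j=1..n. dist (y j) ?z)"
    by (simp add: sum.distrib sum_subtractf sum_distrib_left)
  also have "\<dots> \<le> (\<Sum>j=1..n. dist (y j) x') - (\<Sum>j=1..n. dist (y j) x)"
    using med(1)[unfolded empirical_frechet_median_iff, rule_format, of ?z] by linarith
  also have "\<dots> = (\<Sum>j\<in>{1..n} - {i}. dist (y' j) x') - (\<Sum>j\<in>{1..n} - {i}. dist (y' j) x)
      + dist (y i) x' - dist (y i) x"
  proof -
    have "(\<Sum>j=1..n. dist (y j) u) = dist (y i) u + (\<Sum>j\<in>{1..n} - {i}. dist (y' j) u)" for u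
      using i y' by (subst sum.remove[of _ i]) (auto intro!: sum.cong)
    then show ?thesis by simp
  qed
  also have "\<dots> = ((\<Sum>j=1..n. dist (y' j) x') - (\<Sum>j=1..n. dist (y' j) x))
      + (dist (y' i) x - dist (y' i) x') + (dist (y i) x' - dist (y i) x)"
  proof -
    have "(\<Sum>j=1..n. dist (y' j) u) = dist (y' i) u + (\<Sum>j\<in>{1..n} - {i}. dist (y' j) u)" for u
      using i by (intro sum.remove) auto
    then show ?thesis by simp
  qed
  also have "\<dots> \<le> 0 + ?d + ?d"
    using med(2)[unfolded empirical_frechet_median_iff, rule_format, of x]
      dist_triangle[of "y' i" x x'] dist_triangle[of "y i" x' x]
    by (intro add_mono) (auto simp: dist_commute)
  finally have "c * (w\<^sup>2 * ?d\<^sup>2 / (8 * R)) \<le> 2 * ?d" by simp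
  then have "?d * (c * w\<^sup>2 * ?d) \<le> ?d * (16 * R)"
    using \<open>0 < R\<close> by (simp add: field_simps power2_eq_square)
  then have "c * w\<^sup>2 * ?d \<le> 16 * R"
    by (rule mult_left_le_imp_le) (use False in simp)
  then show ?thesis using c by (simp add: field_simps)
qed

text \<open>
In a nonseparable space, optimality is a condition on uncountably many points. For samples from
the closure of a countable set it can be tested on countably many: take near-minimisers for each of
the countably many samples from \<open>D\<close>; the sum of distances is Lipschitz in the sample. This makes
optimality of a median an almost sure property of the law of the sample.
\<close>

lemma countable_test_set_for_medians:
  fixes D :: "'a::metric_space set"
  assumes "countable D"
  shows "\<exists>C. countable C \<and> (\<forall>y x. (\<forall>j\<in>{1..n}. y j \<in> closure D) \<longrightarrow>
      (\<forall>c\<in>C. (\<Sum>j=1..n. dist (y j) x) \<le> (\<Sum>j=1..n. dist (y j) c)) \<longrightarrow>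
      empirical_frechet_median n y x)"
proof -
  let ?S = "\<lambda>y q. \<Sum>j=1..n. dist (y j) q"
  have "\<exists>c. \<forall>q. ?S e c \<le> ?S e q + 1 / real (Suc k)" for e :: "nat \<Rightarrow> 'a" and k
  proof -
    have bdd: "bdd_below (range (?S e))" by (intro bdd_belowI[of _ 0]) (auto intro: sum_nonneg)
    have "Inf (range (?S e)) < Inf (range (?S e)) + 1 / real (Suc k)" by simp
    then obtain c where "?S e c < Inf (range (?S e)) + 1 / real (Suc k)"
      using cInf_lessD[of "range (?S e)"] by blast
    moreover have "Inf (range (?S e)) \<le> ?S e q" for q by (intro cInf_lower bdd) auto
    ultimately show ?thesis by (intro exI[of _ c]) (meson add_right_mono less_imp_le order_trans)
  qed
  note ex = this
  define near where "near e k = (SOME c. \<forall>q. ?S e c \<le> ?S e q + 1 / real (Suc k))" for e :: "nat \<Rightarrow> 'a" and k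
  have near: "?S e (near e k) \<le> ?S e q + 1 / real (Suc k)" for e :: "nat \<Rightarrow> 'a" and k q
    unfolding near_def by (rule spec[OF someI_ex[OF ex]])
  define C where "C = (\<lambda>(e, k). near e k) ` (({1..n} \<rightarrow>\<^sub>E D) \<times> UNIV)"
  have "countable C"
    unfolding C_def using assms
    by (intro countable_image countable_SIGMA countable_PiE finite_atLeastAtMost countableI_type)
  moreover have "empirical_frechet_median n y x"
    if y: "\<forall>j\<in>{1..n}. y j \<in> closure D" and C: "\<forall>c\<in>C. ?S y x \<le> ?S y c" for y x
    unfolding empirical_frechet_median_iff
  proof (rule allI, rule field_le_epsilon)
    fix q and \<epsilon> :: real assume "0 < \<epsilon>"
    \<comment> \<open>the sum over \<open>n\<close> coordinates has to stay below \<open>\<epsilon> / 4\<close>, also for \<open>n = 0\<close>\<close>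
    define \<delta> where "\<delta> = \<epsilon> / (4 * real (Suc n))"
    have "0 < \<delta>" using \<open>0 < \<epsilon>\<close> by (simp add: \<delta>_def)
    have "\<forall>j\<in>{1..n}. \<exists>a\<in>D. dist a (y j) < \<delta>"
      using y \<open>0 < \<delta>\<close> by (simp add: closure_approachable)
    then have "\<forall>j\<in>{1..n}. \<exists>a. a \<in> D \<and> dist a (y j) < \<delta>" by blast
    from bchoice[OF this] obtain e where e: "\<And>j. j \<in> {1..n} \<Longrightarrow> e j \<in> D \<and> dist (e j) (y j) < \<delta>"
      by blast
    define e' where "e' = restrict e {1..n}"
    obtain k where k: "1 / real (Suc k) < \<epsilon> / 2"
      using nat_approx_posE[of "\<epsilon> / 2"] \<open>0 < \<epsilon>\<close> by auto
    have diff: "\<bar>?S y u - ?S e' u\<bar> \<le> \<epsilon> / 4" for u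
    proof -
      have "\<bar>?S y u - ?S e' u\<bar> \<le> (\<Sum>j=1..n. \<bar>dist (y j) u - dist (e' j) u\<bar>)"
        by (simp add: sum_abs flip: sum_subtractf)
      also have "\<dots> \<le> (\<Sum>j=1..n. \<delta>)"
      proof (rule sum_mono)
        fix j assume "j \<in> {1..n}"
        then have "dist (e' j) (y j) \<le> \<delta>" using e[of j] by (simp add: e'_def)
        then show "\<bar>dist (y j) u - dist (e' j) u\<bar> \<le> \<delta>"
          using dist_triangle[of "y j" u "e' j"] dist_triangle[of "e' j" u "y j"]
          by (simp add: dist_commute abs_le_iff)
      qed
      also have "\<dots> \<le> real (Suc n) * \<delta>" using \<open>0 < \<delta>\<close> by (simp add: algebra_simps)
      also have "\<dots> = \<epsilon> / 4" unfolding \<delta>_def by (simp add: divide_simps)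
      finally show ?thesis .
    qed
    have "near e' k \<in> C"
      unfolding C_def using e by (intro image_eqI[of _ _ "(e', k)"]) (simp_all add: e'_def)
    then have "?S y x \<le> ?S y (near e' k)" using C by blast
    also have "\<dots> \<le> ?S e' (near e' k) + \<epsilon> / 4" using diff[of "near e' k"] by linarith
    also have "\<dots> \<le> ?S e' q + 1 / real (Suc k) + \<epsilon> / 4" using near by simp
    also have "\<dots> \<le> ?S y q + \<epsilon>" using diff[of q] k by linarith
    finally show "?S y x \<le> ?S y q + \<epsilon>" .
  qed
  ultimately show ?thesis by (intro exI[of _ C]) blast
qed

text \<open>
The expected version of \<open>midpt_gain\<close>: away from the bow tie between \<open>m\<close> and \<open>q\<close>, which
carries probability at most \<open>1 - \<eta>\<close>, the distance to \<open>Y\<close> gains convexity between \<open>m\<close> and \<open>q\<close>. The gain degrades with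
the distance of \<open>Y\<close>, so only the event that this distance is at most some large \<open>K\<close> is used. Since
\<open>m\<close> is a minimiser, the midpoint is not better than \<open>m\<close>, and the whole gain shows up at \<open>q\<close>.
\<close>

lemma (in prob_space) median_variance_inequality:
  fixes Y :: "'a \<Rightarrow> 'b::hadamard_space"
  assumes Y [measurable]: "random_variable borel Y"
    and med: "frechet_median M Y m"
    and "0 < w" "0 \<le> R"
    and sup: "(SUP p\<in>cball m R. prob {\<omega>\<in>space M. Y \<omega> \<in> bow_tie m p w}) < 1"
  shows "\<exists>c>0. \<forall>q\<in>cball m R. c * (dist m q)\<^sup>2 \<le> (\<integral>\<omega>. (dist (Y \<omega>) q - dist (Y \<omega>) m) \<partial>M)"
proof -
  let ?F = "\<lambda>q. \<integral>\<omega>. (dist (Y \<omega>) q - dist (Y \<omega>) m) \<partial>M"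
  define \<eta> where "\<eta> = 1 - (SUP p\<in>cball m R. prob {\<omega>\<in>space M. Y \<omega> \<in> bow_tie m p w})"
  have "0 < \<eta>" using sup by (simp add: \<eta>_def)
  have int: "integrable M (\<lambda>\<omega>. dist (Y \<omega>) q - dist (Y \<omega>) m)" for q
  proof (rule integrable_const_bound[of _ "dist m q"])
    show "AE \<omega> in M. norm (dist (Y \<omega>) q - dist (Y \<omega>) m) \<le> dist m q"
      using dist_triangle[of "Y _" q m] dist_triangle2[of "Y _" m q]
      by (auto simp: abs_le_iff dist_commute algebra_simps)
  qed measurable
  have F0: "0 \<le> ?F q" for q
    using med[unfolded frechet_median_def, rule_format, of m] by (simp add: is_arg_min_linorder)
  obtain K :: nat where K: "prob {\<omega>\<in>space M. real K < dist (Y \<omega>) m} < \<eta> / 2"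
  proof -
    have "(\<lambda>k. prob {\<omega>\<in>space M. real k < dist (Y \<omega>) m}) \<longlonglongrightarrow> prob (\<Inter>k. {\<omega>\<in>space M. real k < dist (Y \<omega>) m})"
    proof (intro finite_Lim_measure_decseq)
      show "range (\<lambda>k. {\<omega>\<in>space M. real k < dist (Y \<omega>) m}) \<subseteq> events"
        by (intro image_subsetI) measurable
      show "decseq (\<lambda>k. {\<omega>\<in>space M. real k < dist (Y \<omega>) m})"
        by (intro decseq_SucI Collect_mono) simp
    qed
    moreover have "(\<Inter>k. {\<omega>\<in>space M. real k < dist (Y \<omega>) m}) = {}"
    proof -
      have "\<exists>k. \<not> real k < dist (Y \<omega>) m" for \<omega>
        using real_arch_simple[of "dist (Y \<omega>) m"] by (simp add: not_less)
      then show ?thesis by blast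
    qed
    ultimately have "(\<lambda>k. prob {\<omega>\<in>space M. real k < dist (Y \<omega>) m}) \<longlonglongrightarrow> 0" by simp
    from order_tendstoD(2)[OF this, of "\<eta> / 2"] \<open>0 < \<eta>\<close> that show ?thesis
      by (auto simp: eventually_sequentially)
  qed
  define B where "B = real K + R + 1"
  have "0 < B" using \<open>0 \<le> R\<close> by (simp add: B_def)
  define c where "c = \<eta> / 2 * w\<^sup>2 / (4 * B)"
  have "0 < c" using \<open>0 < \<eta>\<close> \<open>0 < w\<close> \<open>0 < B\<close> by (simp add: c_def)
  moreover have "c * (dist m q)\<^sup>2 \<le> ?F q" if q: "q \<in> cball m R" for q
  proof (cases "q = m")
    case False
    note [measurable] = bow_tie_borel[OF False[symmetric], of w]
    let ?z = "midpt m q"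
    define G where "G = {\<omega>\<in>space M. Y \<omega> \<notin> bow_tie m q w \<and> dist (Y \<omega>) m \<le> real K}"
    have [measurable]: "G \<in> events" unfolding G_def by measurable
    have "prob {\<omega>\<in>space M. Y \<omega> \<in> bow_tie m q w} \<le> 1 - \<eta>"
      unfolding \<eta>_def using q by (auto intro!: cSUP_upper bdd_aboveI[of _ 1])
    moreover have "1 \<le> prob (G \<union> ({\<omega>\<in>space M. Y \<omega> \<in> bow_tie m q w} \<union> {\<omega>\<in>space M. real K < dist (Y \<omega>) m}))"
    proof -
      have "G \<union> ({\<omega>\<in>space M. Y \<omega> \<in> bow_tie m q w} \<union> {\<omega>\<in>space M. real K < dist (Y \<omega>) m}) = space M"
        by (auto simp: G_def)
      then show ?thesis by (simp add: prob_space)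
    qed
    moreover have "prob (G \<union> ({\<omega>\<in>space M. Y \<omega> \<in> bow_tie m q w} \<union> {\<omega>\<in>space M. real K < dist (Y \<omega>) m}))
      \<le> prob G + prob ({\<omega>\<in>space M. Y \<omega> \<in> bow_tie m q w} \<union> {\<omega>\<in>space M. real K < dist (Y \<omega>) m})"
      by (intro measure_Un_le) measurable
    moreover have "prob ({\<omega>\<in>space M. Y \<omega> \<in> bow_tie m q w} \<union> {\<omega>\<in>space M. real K < dist (Y \<omega>) m})
      \<le> prob {\<omega>\<in>space M. Y \<omega> \<in> bow_tie m q w} + prob {\<omega>\<in>space M. real K < dist (Y \<omega>) m}"
      by (intro measure_Un_le) measurable
    ultimately have pG: "\<eta> / 2 \<le> prob G" using K by linarith
    let ?e = "w\<^sup>2 * (dist m q)\<^sup>2 / (4 * B)"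
    have gain: "indicator G \<omega> * ?e \<le> (dist (Y \<omega>) q - dist (Y \<omega>) m) - 2 * (dist (Y \<omega>) ?z - dist (Y \<omega>) m)" for \<omega>
    proof (cases "\<omega> \<in> G")
      case True
      then have "dist (Y \<omega>) m \<le> B" "dist (Y \<omega>) q \<le> B"
        using q \<open>0 \<le> R\<close> dist_triangle[of "Y \<omega>" q m] by (auto simp: G_def B_def)
      then show ?thesis using midpt_gain[OF False[symmetric], of "Y \<omega>" w B] True by (simp add: G_def)
    next
      case False
      then show ?thesis using dist_midpt_le[of "Y \<omega>" m q] by simp
    qed
    have "c * (dist m q)\<^sup>2 = \<eta> / 2 * ?e" by (simp add: c_def)
    also have "\<dots> \<le> prob G * ?e" using pG \<open>0 < B\<close> by (intro mult_right_mono) auto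
    also have "\<dots> = (\<integral>\<omega>. indicator G \<omega> * ?e \<partial>M)" by simp
    also have "\<dots> \<le> (\<integral>\<omega>. (dist (Y \<omega>) q - dist (Y \<omega>) m) - 2 * (dist (Y \<omega>) ?z - dist (Y \<omega>) m) \<partial>M)"
    proof (rule integral_mono[OF _ _ gain])
      show "integrable M (\<lambda>\<omega>. indicator G \<omega> * ?e)"
        by (intro integrable_mult_left integrable_real_indicator) (simp_all add: less_top[symmetric])
    qed (intro Bochner_Integration.integrable_diff integrable_mult_right int)
    also have "\<dots> = ?F q - 2 * ?F ?z"
      by (simp only: Bochner_Integration.integral_diff[OF int integrable_mult_right[OF int]]
          integral_mult_right_zero)
    also have "\<dots> \<le> ?F q" using F0[of ?z] by simp
    finally show ?thesis .
  qed simp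
  ultimately show ?thesis by blast
qed

section \<open>Second moments from power-type tails\<close>

lemma geometric_tail_bound:
  fixes N :: nat
  shows "(1/2::real) ^ N \<le> 1 / (real N + 1)"
proof -
  have "real N + 1 \<le> 2 ^ N" by (induction N) auto
  then show ?thesis by (simp add: power_one_over field_simps)
qed

text \<open>
Cut at the dyadic levels \<open>4 * 2 ^ k * r\<close>. With \<open>K\<close> of order \<open>n / 3\<close>, the level \<open>k\<close> contributes
a multiple of \<open>4 ^ k * (8 * \<pi> (2 ^ k * r)) ^ K\<close>. A fixed number \<open>a \<ge> 3 / \<xi>\<close> of the \<open>K\<close> factors is
spent on the power decay of \<open>\<pi>\<close>, which yields \<open>(1/8) ^ k\<close> and makes the sum over \<open>k\<close> finite;
each remaining factor is at most \<open>8 / 27 < 1 / 2\<close>, which yields geometric decay in \<open>n\<close>. So an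
arbitrarily small moment \<open>\<xi>\<close> suffices.
\<close>

lemma second_moment_of_light_tails:
  fixes N :: "nat \<Rightarrow> 'b measure" and D :: "nat \<Rightarrow> 'b \<Rightarrow> real" and \<pi> :: "real \<Rightarrow> real"
  assumes D [measurable]: "\<And>n. n \<ge> 1 \<Longrightarrow> D n \<in> borel_measurable (N n)"
    and r: "0 < r" and \<xi>: "0 < \<xi>"
    and \<pi>: "\<And>s. r \<le> s \<Longrightarrow> 0 \<le> \<pi> s" "\<And>s. r \<le> s \<Longrightarrow> \<pi> s \<le> 1 / 27" "\<And>s. r \<le> s \<Longrightarrow> \<pi> s \<le> B * s powr (- \<xi>)"
    and tail: "\<And>n s. n \<ge> 1 \<Longrightarrow> r \<le> s \<Longrightarrow>
      emeasure (N n) {x\<in>space (N n). 4 * s < D n x} \<le> ennreal ((8 * \<pi> s) ^ ((n + 2) div 3))"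
  shows "\<exists>C n0. 0 \<le> C \<and> 1 \<le> n0 \<and> (\<forall>n\<ge>n0.
      (\<integral>\<^sup>+x. ennreal ((D n x)\<^sup>2 * indicator {4 * r<..} (D n x)) \<partial>N n) \<le> ennreal (C / real n))"
proof -
  define a where "a = nat \<lceil>3 / \<xi>\<rceil>"
  have a: "3 \<le> \<xi> * real a"
  proof -
    have "3 / \<xi> \<le> real a" unfolding a_def by (rule real_nat_ceiling_ge)
    then show ?thesis using \<xi> by (simp add: field_simps)
  qed
  have B: "0 \<le> B"
  proof -
    have "0 \<le> B * r powr (- \<xi>)" using \<pi>(1,3)[of r] by simp
    then show ?thesis using r by (simp add: zero_le_mult_iff)
  qed
  define E where "E = (8 * B * r powr (- \<xi>)) ^ a"
  have E: "0 \<le> E" using B by (simp add: E_def)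
  define C where "C = 128 * r\<^sup>2 * E * 6"
  define n0 where "n0 = 6 * a + 6"
  have dyadic: "64 * r\<^sup>2 * 4 ^ k * (8 * \<pi> (2 ^ k * r)) ^ K \<le> 64 * r\<^sup>2 * E * (1/2) ^ (K - a) * (1/2) ^ k"
    if "a \<le> K" for k K :: nat
  proof -
    have s: "r \<le> 2 ^ k * r" using r by simp
    have "8 * \<pi> (2 ^ k * r) \<le> 8 * (B * (2 ^ k * r) powr (- \<xi>))" using \<pi>(3)[OF s] by simp
    also have "\<dots> = 8 * B * r powr (- \<xi>) * 2 powr (- \<xi> * real k)"
      using r by (simp add: powr_mult powr_powr flip: powr_realpow) (simp add: mult.commute)
    finally have "(8 * \<pi> (2 ^ k * r)) ^ a \<le> (8 * B * r powr (- \<xi>) * 2 powr (- \<xi> * real k)) ^ a"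
      using \<pi>(1)[OF s] by (intro power_mono) auto
    also have "\<dots> = E * 2 powr (- \<xi> * real a * real k)"
      by (simp add: E_def power_mult_distrib powr_power mult_ac)
    also have "\<dots> \<le> E * 2 powr (- 3 * real k)"
    proof -
      have "3 * real k \<le> (\<xi> * real a) * real k" using a by (intro mult_right_mono) auto
      then show ?thesis using E by (intro mult_left_mono powr_mono) auto
    qed
    also have "2 powr (- 3 * real k) = (1/8) ^ k"
    proof -
      have "2 powr (- 3 * real k) = (2 powr (-3)) powr real k" by (simp add: powr_powr)
      also have "2 powr (-3) = (1/8::real)" by (simp add: powr_minus_divide)
      finally show ?thesis by (simp add: powr_realpow)
    qed
    finally have 1: "(8 * \<pi> (2 ^ k * r)) ^ a \<le> E * (1/8) ^ k" .
    have 2: "(8 * \<pi> (2 ^ k * r)) ^ (K - a) \<le> (1/2) ^ (K - a)"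
      using \<pi>(1,2)[OF s] by (intro power_mono) auto
    have "(8 * \<pi> (2 ^ k * r)) ^ K = (8 * \<pi> (2 ^ k * r)) ^ a * (8 * \<pi> (2 ^ k * r)) ^ (K - a)"
      using that by (simp only: power_add[symmetric] le_add_diff_inverse)
    also have "\<dots> \<le> (E * (1/8) ^ k) * (1/2) ^ (K - a)"
      using 1 2 \<pi>(1)[OF s] E by (intro mult_mono) auto
    finally have "64 * r\<^sup>2 * 4 ^ k * (8 * \<pi> (2 ^ k * r)) ^ K \<le> 64 * r\<^sup>2 * 4 ^ k * ((E * (1/8) ^ k) * (1/2) ^ (K - a))"
      by (intro mult_left_mono) auto
    also have "\<dots> = 64 * r\<^sup>2 * E * (1/2) ^ (K - a) * (4 ^ k * (1/8) ^ k)" by simp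
    also have "(4::real) ^ k * (1/8) ^ k = (1/2) ^ k" by (simp flip: power_mult_distrib)
    finally show ?thesis .
  qed
  have "(\<integral>\<^sup>+x. ennreal ((D n x)\<^sup>2 * indicator {4 * r<..} (D n x)) \<partial>N n) \<le> ennreal (C / real n)"
    if n: "n0 \<le> n" for n
  proof -
    have [simp]: "1 \<le> n" using n by (simp add: n0_def)
    define K where "K = (n + 2) div 3"
    have "n \<le> 3 * K" by (simp add: K_def)
    have "a \<le> K" using n \<open>n \<le> 3 * K\<close> by (simp add: n0_def)
    let ?A = "\<lambda>k. {x\<in>space (N n). 4 * (2 ^ k * r) < D n x}"
    note [measurable] = D[OF \<open>1 \<le> n\<close>]
    have single: "f j \<le> suminf f" for f :: "nat \<Rightarrow> ennreal" and j
      using sum_le_suminf[of f "{j}"] by simp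
    have pt: "ennreal ((D n x)\<^sup>2 * indicator {4 * r<..} (D n x)) \<le> (\<Sum>k. ennreal (64 * r\<^sup>2 * 4 ^ k) * indicator (?A k) x)"
      if x: "x \<in> space (N n)" for x
    proof (cases "4 * r < D n x")
      case True
      \<comment> \<open>the largest dyadic level below the value\<close>
      define k where "k = (LEAST k. D n x \<le> 4 * (2 ^ Suc k * r))"
      obtain k' :: nat where "D n x / (4 * r) < 2 ^ k'"
        using real_arch_pow[of 2 "D n x / (4 * r)"] by auto
      then have "D n x < 4 * (2 ^ k' * r)" using r by (simp add: field_simps)
      moreover have "4 * (2 ^ k' * r) \<le> 4 * (2 ^ Suc k' * r)" using r by simp
      ultimately have "D n x \<le> 4 * (2 ^ Suc k' * r)" by linarith
      then have k: "D n x \<le> 4 * (2 ^ Suc k * r)" unfolding k_def by (rule LeastI)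
      have "4 * (2 ^ k * r) < D n x"
      proof (cases k)
        case (Suc i)
        then have "\<not> D n x \<le> 4 * (2 ^ Suc i * r)" 
          using not_less_Least[of i "\<lambda>k. D n x \<le> 4 * (2 ^ Suc k * r)"] unfolding k_def by simp
        then show ?thesis using Suc by simp
      qed (use True in simp)
      then have xk: "x \<in> ?A k" using x by simp
      have "(D n x)\<^sup>2 \<le> (4 * (2 ^ Suc k * r))\<^sup>2" using k True r by (intro power_mono) auto
      also have "\<dots> = 64 * r\<^sup>2 * 4 ^ k"
        by (simp add: power_mult_distrib power2_eq_square power_mult[symmetric] flip: power_mult_distrib)
      finally have "ennreal ((D n x)\<^sup>2 * indicator {4 * r<..} (D n x)) \<le> ennreal (64 * r\<^sup>2 * 4 ^ k) * indicator (?A k) x"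
        using xk by (auto simp: indicator_def intro!: ennreal_leI)
      also have "\<dots> \<le> (\<Sum>k. ennreal (64 * r\<^sup>2 * 4 ^ k) * indicator (?A k) x)"
        by (rule single[of "\<lambda>k. ennreal (64 * r\<^sup>2 * 4 ^ k) * indicator (?A k) x"])
      finally show ?thesis .
    qed simp
    have "(\<integral>\<^sup>+x. ennreal ((D n x)\<^sup>2 * indicator {4 * r<..} (D n x)) \<partial>N n)
        \<le> (\<integral>\<^sup>+x. (\<Sum>k. ennreal (64 * r\<^sup>2 * 4 ^ k) * indicator (?A k) x) \<partial>N n)"
      by (intro nn_integral_mono pt)
    also have "\<dots> = (\<Sum>k. ennreal (64 * r\<^sup>2 * 4 ^ k) * emeasure (N n) (?A k))"
      by (subst nn_integral_suminf) (auto simp: nn_integral_cmult_indicator)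
    also have "\<dots> \<le> (\<Sum>k. ennreal (64 * r\<^sup>2 * E * (1/2) ^ (K - a) * (1/2) ^ k))"
    proof (intro suminf_le summableI)
      fix k
      have s: "r \<le> 2 ^ k * r" using r by simp
      have "ennreal (64 * r\<^sup>2 * 4 ^ k) * emeasure (N n) (?A k)
          \<le> ennreal (64 * r\<^sup>2 * 4 ^ k) * ennreal ((8 * \<pi> (2 ^ k * r)) ^ K)"
        unfolding K_def using tail[OF \<open>1 \<le> n\<close> s] by (intro mult_left_mono) auto
      also have "\<dots> = ennreal (64 * r\<^sup>2 * 4 ^ k * (8 * \<pi> (2 ^ k * r)) ^ K)"
        using \<pi>(1)[OF s] by (intro ennreal_mult[symmetric]) auto
      also have "\<dots> \<le> ennreal (64 * r\<^sup>2 * E * (1/2) ^ (K - a) * (1/2) ^ k)"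
        by (intro ennreal_leI dyadic \<open>a \<le> K\<close>)
      finally show "ennreal (64 * r\<^sup>2 * 4 ^ k) * emeasure (N n) (?A k) \<le> ennreal (64 * r\<^sup>2 * E * (1/2) ^ (K - a) * (1/2) ^ k)" .
    qed
    also have "\<dots> = ennreal (64 * r\<^sup>2 * E * (1/2) ^ (K - a) * 2)"
    proof (rule suminf_ennreal_eq)
      show "(\<lambda>k. 64 * r\<^sup>2 * E * (1/2) ^ (K - a) * (1/2) ^ k) sums (64 * r\<^sup>2 * E * (1/2) ^ (K - a) * 2)"
        using sums_mult[OF geometric_sums[of "1/2::real"], of "64 * r\<^sup>2 * E * (1/2) ^ (K - a)"] by simp
    qed (use E in auto)
    also have "\<dots> \<le> ennreal (C / real n)"
    proof (rule ennreal_leI)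
      have "n \<le> 6 * (K - a + 1)"
      proof -
        obtain u where "K = a + u" using \<open>a \<le> K\<close> le_Suc_ex by blast
        then show ?thesis using n \<open>n \<le> 3 * K\<close> by (simp add: n0_def)
      qed
      then have "real n \<le> real (6 * (K - a + 1))" by (simp only: of_nat_le_iff)
      then have "real n \<le> 6 * (real (K - a) + 1)" by simp
      then have "1 / (real (K - a) + 1) \<le> 6 / real n"
        using \<open>1 \<le> n\<close> by (simp add: field_simps)
      with geometric_tail_bound[of "K - a"] have "(1/2) ^ (K - a) \<le> 6 / real n" by linarith
      then have "128 * r\<^sup>2 * E * (1/2) ^ (K - a) \<le> 128 * r\<^sup>2 * E * (6 / real n)"
        using E by (intro mult_left_mono) auto
      then show "64 * r\<^sup>2 * E * (1/2) ^ (K - a) * 2 \<le> C / real n" by (simp add: C_def mult_ac)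
    qed
    finally show ?thesis .
  qed
  moreover have "0 \<le> C" "1 \<le> n0" using E by (auto simp: C_def n0_def)
  ultimately show ?thesis by blast
qed

section \<open>Samples from a law on a separable set\<close>

(* keeps index sets in the form {1..n} under simplification *)
declare One_nat_def [simp del]

locale separable_law = prob_space \<nu> for \<nu> :: "'a::hadamard_space measure" +
  fixes D :: "'a set"
  assumes sets_law [measurable_cong]: "sets \<nu> = sets borel"
    and countable_D: "countable D" and D_nonempty: "D \<noteq> {}"
    and AE_closure_D: "AE y in \<nu>. y \<in> closure D"
begin

abbreviation P :: "nat \<Rightarrow> (nat \<Rightarrow> 'a) measure" where
  "P n \<equiv> PiM {1..n} (\<lambda>_. \<nu>)"

lemma space_law [simp]: "space \<nu> = UNIV"
  using sets_eq_imp_space_eq[OF sets_law] by simp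

lemma prob_space_P: "prob_space (P n)"
  by (rule prob_space_PiM) (rule prob_space_axioms)

text \<open>
The distance itself need not be jointly measurable for the product of two Borel algebras when the
space is not separable. This function is, as a countable infimum, and it agrees with the distance
as soon as the first argument lies in the closure of \<open>D\<close>.
\<close>

definition sdist :: "'a \<Rightarrow> 'a \<Rightarrow> real" where
  "sdist y q = (INF s\<in>D. dist y s + dist s q)"

lemma sdist_eq_dist:
  assumes "y \<in> closure D"
  shows "sdist y q = dist y q"
proof (rule antisym)
  have bdd: "bdd_below ((\<lambda>s. dist y s + dist s q) ` D)"
    by (intro bdd_belowI[of _ 0]) auto
  show "sdist y q \<le> dist y q"
  proof (rule field_le_epsilon)
    fix e :: real assume "0 < e"
    then obtain s where s: "s \<in> D" "dist s y < e / 2"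
      using assms by (meson closure_approachable half_gt_zero)
    have "sdist y q \<le> dist y s + dist s q" unfolding sdist_def using s by (intro cINF_lower bdd)
    also have "\<dots> \<le> dist y q + e"
      using s dist_triangle[of s q y] by (simp add: dist_commute)
    finally show "sdist y q \<le> dist y q + e" .
  qed
  show "dist y q \<le> sdist y q"
    unfolding sdist_def using D_nonempty by (intro cINF_greatest dist_triangle)
qed

lemma borel_measurable_sdist [measurable (raw)]:
  assumes [measurable]: "f \<in> measurable M borel" "g \<in> measurable M borel"
  shows "(\<lambda>x. sdist (f x) (g x)) \<in> borel_measurable M"
  unfolding sdist_def by (intro borel_measurable_cINF_real countable_D) measurable

lemma AE_P_closure: "AE y in P n. \<forall>j\<in>{1..n}. y j \<in> closure D"
proof (rule AE_finite_allI)
  fix j assume "j \<in> {1..n}"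
  then show "AE y in P n. y j \<in> closure D"
    by (intro AE_PiM_component AE_closure_D prob_space_axioms)
qed simp

lemma distr_P_reindex:
  assumes "inj_on f {1..k}" "f ` {1..k} \<subseteq> {1..n}"
  shows "distr (P n) (P k) (\<lambda>y. \<lambda>j\<in>{1..k}. y (f j)) = P k"
  using distr_PiM_reindex[of "{1..n}" "\<lambda>_. \<nu>" f "{1..k}"] assms prob_space_axioms by auto

lemma measurable_P_reindex:
  assumes "f ` {1..k} \<subseteq> {1..n}"
  shows "(\<lambda>y. \<lambda>j\<in>{1..k}. y (f j)) \<in> measurable (P n) (P k)"
  by (intro measurable_restrict measurable_component_singleton) (use assms in blast)

text \<open>
Optimality is known along one sample \<open>X\<close> only. Tested on a countable set and
expressed with \<^const>\<open>sdist\<close>, it becomes a measurable condition and therefore passes to the law of \<open>X\<close>.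
This gives access to samples with exchanged coordinates.
\<close>

lemma AE_empirical_median:
  assumes g [measurable]: "g \<in> measurable (P n) borel"
    and X: "X \<in> measurable M (P n)" "distr M (P n) X = P n"
    and med: "\<And>\<omega>. \<omega> \<in> space M \<Longrightarrow> empirical_frechet_median n (X \<omega>) (g (X \<omega>))"
  shows "AE y in P n. empirical_frechet_median n y (g y)"
proof -
  obtain C where "countable C" and C: "\<And>y x. \<forall>j\<in>{1..n}. y j \<in> closure D \<Longrightarrow>
      \<forall>c\<in>C. (\<Sum>j=1..n. dist (y j) x) \<le> (\<Sum>j=1..n. dist (y j) c) \<Longrightarrow> empirical_frechet_median n y x"
    using countable_test_set_for_medians[OF countable_D, of n] by blast
  let ?B = "\<lambda>c y. (\<Sum>j=1..n. sdist (y j) (g y)) \<le> (\<Sum>j=1..n. dist (y j) c)"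
  have "AE y in P n. ?B c y" if "c \<in> C" for c
  proof -
    have meas: "{y \<in> space (P n). ?B c y} \<in> sets (P n)" by measurable
    have AE_X: "AE \<omega> in M. ?B c (X \<omega>)"
    proof -
      have "AE y in distr M (P n) X. \<forall>j\<in>{1..n}. y j \<in> closure D"
        unfolding X(2) by (rule AE_P_closure)
      then have "AE \<omega> in M. \<forall>j\<in>{1..n}. X \<omega> j \<in> closure D"
        by (rule AE_distrD[OF X(1)])
      then show ?thesis
      proof (rule AE_mp, intro AE_I2 impI)
        fix \<omega> assume "\<omega> \<in> space M" "\<forall>j\<in>{1..n}. X \<omega> j \<in> closure D"
        then show "?B c (X \<omega>)"
          using med[of \<omega>] by (simp add: empirical_frechet_median_iff sdist_eq_dist)
      qed
    qed
    have "AE y in distr M (P n) X. ?B c y"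
      by (rule iffD2[OF AE_distr_iff[OF X(1) meas] AE_X])
    from this[unfolded X(2)] show ?thesis .
  qed
  then have "AE y in P n. \<forall>c\<in>C. ?B c y"
    using \<open>countable C\<close> by (simp add: AE_ball_countable)
  with AE_P_closure[of n] show ?thesis
    by eventually_elim (rule C, simp_all add: sdist_eq_dist)
qed

text \<open>
Union bound over the at most \<open>2 ^ n\<close> index sets \<open>J\<close> with exactly \<open>k = \<lceil>n / 3\<rceil>\<close> elements, and
\<open>2 ^ n \<le> 8 ^ k\<close>.
\<close>

lemma emeasure_many_far:
  "emeasure (P n) {y\<in>space (P n). n \<le> 3 * card {j\<in>{1..n}. s < dist (y j) m}}
     \<le> ennreal ((8 * prob {y. s < dist y m}) ^ ((n + 2) div 3))"
proof -
  interpret PP: product_prob_space "\<lambda>_::nat. \<nu>" "{1..n}" by unfold_locales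
  define k where "k = (n + 2) div 3"
  define F where "F = {y. s < dist y m}"
  have "{y\<in>space \<nu>. s < dist y m} \<in> events" by measurable
  then have F: "F \<in> events" by (simp add: F_def)
  define Js where "Js = {J. J \<subseteq> {1..n} \<and> card J = k}"
  define A where "A J = (\<Pi>\<^sub>E j\<in>{1..n}. if j \<in> J then F else space \<nu>)" for J
  have "finite Js" unfolding Js_def by (rule finite_subset[of _ "Pow {1..n}"]) auto
  have A: "A J \<in> sets (P n)" for J unfolding A_def using F by (intro sets_PiM_I_finite) auto
  have eA: "emeasure (P n) (A J) = ennreal (prob F ^ k)" if "J \<in> Js" for J
  proof -
    have J: "J \<subseteq> {1..n}" "card J = k" using that by (auto simp: Js_def)
    have "emeasure (P n) (A J) = (\<Prod>j\<in>{1..n}. emeasure \<nu> (if j \<in> J then F else space \<nu>))"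
      unfolding A_def using F by (intro PP.emeasure_PiM) auto
    also have "\<dots> = (\<Prod>j\<in>{1..n}. if j \<in> J then ennreal (prob F) else 1)"
      by (intro prod.cong) (auto simp: emeasure_eq_measure prob_space[simplified])
    also have "\<dots> = (\<Prod>j\<in>{1..n} \<inter> J. ennreal (prob F))"
      by (subst prod.inter_restrict) auto
    also have "\<dots> = ennreal (prob F ^ k)"
      using J by (simp add: Int_absorb1 ennreal_power)
    finally show ?thesis .
  qed
  have "{y\<in>space (P n). n \<le> 3 * card {j\<in>{1..n}. s < dist (y j) m}} \<subseteq> (\<Union>J\<in>Js. A J)"
  proof
    fix y assume y: "y \<in> {y\<in>space (P n). n \<le> 3 * card {j\<in>{1..n}. s < dist (y j) m}}"
    then have "k \<le> card {j\<in>{1..n}. s < dist (y j) m}" unfolding k_def by auto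
    then obtain J where J: "J \<subseteq> {j\<in>{1..n}. s < dist (y j) m}" "card J = k"
      by (rule obtain_subset_with_card_n) (blast intro: that)
    then have "J \<in> Js" "y \<in> A J"
      using y by (auto simp: Js_def A_def F_def space_PiM PiE_iff)
    then show "y \<in> (\<Union>J\<in>Js. A J)" by blast
  qed
  then have "emeasure (P n) {y\<in>space (P n). n \<le> 3 * card {j\<in>{1..n}. s < dist (y j) m}}
      \<le> emeasure (P n) (\<Union>J\<in>Js. A J)"
    using A \<open>finite Js\<close> by (intro emeasure_mono sets.finite_UN) auto
  also have "\<dots> \<le> (\<Sum>J\<in>Js. emeasure (P n) (A J))"
    using A \<open>finite Js\<close> by (intro emeasure_subadditive_finite) auto
  also have "\<dots> = (\<Sum>J\<in>Js. ennreal (prob F ^ k))"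
    by (intro sum.cong refl eA)
  also have "\<dots> = ennreal (real (card Js) * prob F ^ k)"
    by (simp add: ennreal_mult' ennreal_of_nat_eq_real_of_nat)
  also have "\<dots> \<le> ennreal (8 ^ k * prob F ^ k)"
  proof (intro ennreal_leI mult_right_mono)
    have "card Js \<le> card (Pow {1..n})" by (intro card_mono) (auto simp: Js_def)
    also have "\<dots> = 2 ^ n" by (simp add: card_Pow)
    also have "\<dots> \<le> 2 ^ (3 * k)" by (intro power_increasing) (auto simp: k_def)
    also have "(2::nat) ^ (3 * k) = 8 ^ k" by (simp add: power_mult)
    finally have "real (card Js) \<le> real (8 ^ k)" by (simp only: of_nat_le_iff)
    then show "real (card Js) \<le> 8 ^ k" by simp
  qed simp
  finally show ?thesis by (simp add: power_mult_distrib k_def F_def)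
qed

lemma median_tail:
  assumes g [measurable]: "g \<in> measurable (P n) borel"
    and med: "AE y in P n. empirical_frechet_median n y (g y)"
  shows "emeasure (P n) {y\<in>space (P n). 4 * s < dist m (g y)}
     \<le> ennreal ((8 * prob {y. s < dist y m}) ^ ((n + 2) div 3))"
proof -
  have eq: "card {j\<in>{1..n}. s < dist (y j) m} = (\<Sum>j=1..n. of_bool (s < dist (y j) m))" for y :: "nat \<Rightarrow> 'a"
    by (simp add: Int_def)
  have "{y\<in>space (P n). n \<le> 3 * card {j\<in>{1..n}. s < dist (y j) m}} \<in> sets (P n)"
    unfolding eq by measurable
  moreover have "AE y in P n. y \<in> {y\<in>space (P n). 4 * s < dist m (g y)} \<longrightarrow>
      y \<in> {y\<in>space (P n). n \<le> 3 * card {j\<in>{1..n}. s < dist (y j) m}}"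
    using med by eventually_elim (use median_breakdown in \<open>force simp: not_le[symmetric]\<close>)
  ultimately have "emeasure (P n) {y\<in>space (P n). 4 * s < dist m (g y)}
      \<le> emeasure (P n) {y\<in>space (P n). n \<le> 3 * card {j\<in>{1..n}. s < dist (y j) m}}"
    by (intro emeasure_mono_AE)
  then show ?thesis using emeasure_many_far order_trans by blast
qed

text \<open>
The blocks of length \<open>l\<close> are disjoint, so the indicators are independent with mean
\<open>measure (P l) A\<close>, and Hoeffding's inequality applies with deviation half of the mean.
\<close>

lemma block_hits_concentration:
  assumes A [measurable]: "A \<in> sets (P l)" and "0 < K" "K * l \<le> n" "1 \<le> n"
  shows "{y\<in>space (P n). (\<Sum>b<K. indicator A (\<lambda>j\<in>{1..l}. y (b * l + j)))
      \<le> real K * measure (P l) A / 2} \<in> sets (P n)" (is ?sets)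
    and "measure (P n) {y\<in>space (P n). (\<Sum>b<K. indicator A (\<lambda>j\<in>{1..l}. y (b * l + j)))
      \<le> real K * measure (P l) A / 2} \<le> exp (- (real K * (measure (P l) A)\<^sup>2 / 2))" (is ?bound)
proof -
  interpret Pn: prob_space "P n" by (rule prob_space_P)
  let ?p = "measure (P l) A"
  define blk where "blk b y = (\<lambda>j\<in>{1..l}. y (b * l + j))" for b and y :: "nat \<Rightarrow> 'a"
  define X where "X b y = (indicator A (blk b y) :: real)" for b y
  have sub: "(\<lambda>j. b * l + j) ` {1..l} \<subseteq> {1..n}" if "b < K" for b
  proof -
    have "b * l + l \<le> K * l" using mult_le_mono1[of "Suc b" K l] that by simp
    then show ?thesis using \<open>K * l \<le> n\<close> by auto
  qed
  have blk_meas: "blk b \<in> measurable (P n) (P l)" if "b < K" for b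
    unfolding blk_def by (rule measurable_P_reindex[OF sub[OF that]])
  have E: "Pn.expectation (X b) = ?p" if "b < K" for b
  proof -
    have "Pn.expectation (X b) = (\<integral>z. indicator A z \<partial>distr (P n) (P l) (blk b))"
      
      unfolding X_def by (rule integral_distr[symmetric]) (use blk_meas[OF that] in measurable)
    also have "distr (P n) (P l) (blk b) = P l"
      unfolding blk_def by (rule distr_P_reindex[OF _ sub[OF that]]) (simp add: inj_on_def)
    finally show ?thesis using sets.sets_into_space[OF A] by (simp add: Int_absorb2)
  qed
  have ind: "Pn.indep_vars (\<lambda>_. \<nu>) (\<lambda>i y. y i) {1..n}"
  proof (subst Pn.indep_vars_iff_distr_eq_PiM')
    show "distr (P n) (P n) (\<lambda>x. \<lambda>i\<in>{1..n}. x i) = PiM {1..n} (\<lambda>i. distr (P n) \<nu> (\<lambda>y. y i))"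
    proof -
      have "PiM {1..n} (\<lambda>i. distr (P n) \<nu> (\<lambda>y. y i)) = P n"
        by (intro PiM_cong refl distr_PiM_component prob_space_axioms)
      then show ?thesis using distr_P_reindex[of id n n] by simp
    qed
  qed (use \<open>1 \<le> n\<close> in auto)
  define I where "I b = (\<lambda>j. b * l + j) ` {1..l}" for b
  have subI: "I b \<subseteq> {1..n}" if "b \<in> {..<K}" for b
    unfolding I_def using that by (intro sub) simp
  have disj: "disjoint_family_on I {..<K}"
  proof -
    have "b = b'" if "b * l + j = b' * l + j'" "j \<in> {1..l}" "j' \<in> {1..l}" for b b' j j'
    proof -
      have div: "(c * l + u) div l = c" if "u < l" for c u :: nat using that by simp
      have "j - 1 < l" "j' - 1 < l" "b * l + (j - 1) = b' * l + (j' - 1)" using that by auto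
      then show ?thesis using div[of "j - 1" b] div[of "j' - 1" b'] by simp
    qed
    note inj = this
    show ?thesis
    unfolding disjoint_family_on_def
    proof (intro ballI impI, rule ccontr)
      fix b b' assume "b \<noteq> b'" "I b \<inter> I b' \<noteq> {}"
      then obtain j j' where "j \<in> {1..l}" "j' \<in> {1..l}" "b * l + j = b' * l + j'"
        unfolding I_def by blast
      with inj \<open>b \<noteq> b'\<close> show False by blast
    qed
  qed
  have "Pn.indep_vars (\<lambda>b. PiM (I b) (\<lambda>_. \<nu>)) (\<lambda>b y. restrict (\<lambda>i. y i) (I b)) {..<K}"
    by (rule Pn.indep_vars_restrict[OF ind subI disj])
  then have "Pn.indep_vars (\<lambda>_. borel) (\<lambda>b y. X b (restrict (\<lambda>i. y i) (I b))) {..<K}"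
  proof (rule Pn.indep_vars_compose2)
    fix b
    have "blk b \<in> measurable (PiM (I b) (\<lambda>_. \<nu>)) (P l)"
      unfolding blk_def by (intro measurable_restrict measurable_component_singleton) (auto simp: I_def)
    then show "X b \<in> borel_measurable (PiM (I b) (\<lambda>_. \<nu>))" unfolding X_def by measurable
  qed
  moreover have "X b (restrict (\<lambda>i. y i) (I b)) = X b y" for b y
    unfolding X_def blk_def by (intro arg_cong[of _ _ "indicator A"]) (auto simp: I_def fun_eq_iff)
  ultimately have indep: "Pn.indep_vars (\<lambda>_. borel) X {..<K}" by simp
  interpret H: Hoeffding_ineq "P n" "{..<K}" X "\<lambda>_. 0" "\<lambda>_. 1" "\<Sum>b<K. Pn.expectation (X b)"
    by unfold_locales (auto simp: indep X_def indicator_def)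
  have "Pn.prob {y\<in>space (P n). (\<Sum>b<K. X b y) \<le> (\<Sum>b<K. Pn.expectation (X b)) - real K * ?p / 2}
      \<le> exp (- 2 * (real K * ?p / 2)\<^sup>2 / (\<Sum>b<K. (1 - 0)\<^sup>2))"
    using \<open>0 < K\<close> by (intro H.Hoeffding_ineq_le) auto
  also have "(\<Sum>b<K. Pn.expectation (X b)) = real K * ?p" by (simp add: E)
  also have "real K * ?p - real K * ?p / 2 = real K * ?p / 2" by simp
  also have "- 2 * (real K * ?p / 2)\<^sup>2 / (\<Sum>b<K. (1 - 0)\<^sup>2) = - (real K * ?p\<^sup>2 / 2)"
    using \<open>0 < K\<close> by (simp add: power2_eq_square field_simps)
  finally show ?bound by (simp add: X_def blk_def)
  have [measurable]: "X b \<in> borel_measurable (P n)" if "b < K" for b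
    using blk_meas[OF that] unfolding X_def by measurable
  have "{y\<in>space (P n). (\<Sum>b<K. X b y) \<le> real K * ?p / 2} \<in> sets (P n)" by measurable
  then show ?sets by (simp add: X_def blk_def)
qed

section \<open>Excess risk of a stable median\<close>

lemma integrable_dist_diff: "integrable \<nu> (\<lambda>y. dist y q - dist y m)"
proof (rule integrable_const_bound[of _ "dist q m"])
  show "AE y in \<nu>. norm (dist y q - dist y m) \<le> dist q m"
  proof (rule AE_I2)
    fix y
    show "norm (dist y q - dist y m) \<le> dist q m"
      using dist_triangle[of y q m] dist_triangle2[of y m q] by (simp add: dist_commute abs_le_iff)
  qed
qed measurable

text \<open>
Stability implies generalisation. Let \<open>x\<close> be the median of observations \<open>1..n\<close> and
\<open>x\<^sub>i\<close> the one after observation \<open>i\<close> has been exchanged with a fresh observation \<open>n + 1\<close>. The pair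
(fresh observation, \<open>x\<close>) has the law of the pair (observation \<open>i\<close>, \<open>x\<^sub>i\<close>), so the expected excess
distance of a fresh observation to \<open>x\<close> is the expectation of the average over \<open>i\<close> of
\<open>dist (y i) x\<^sub>i - dist (y i) m\<close>. Replacing \<open>x\<^sub>i\<close> by \<open>x\<close> costs \<open>dist x x\<^sub>i\<close>, which is at most \<open>\<rho>\<close> off
the exceptional events, and makes the average nonpositive since \<open>x\<close> is optimal. On the
other hand Fubini's theorem turns the excess into the risk at \<open>x\<close>, which dominates
\<open>c * (dist m x)\<^sup>2\<close> on the ball.

The function \<open>T\<close> isolates the event that the median leaves the ball of radius \<open>4 * r\<close>; there
\<open>d \<le> T d / (4 * r)\<close>, so second moments control first moments.
\<close>

lemma expected_excess_of_stable_median: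
  fixes m :: 'a and r \<rho> c :: real
  defines "T \<equiv> \<lambda>d. d\<^sup>2 * indicator {4 * r<..} d" and "S \<equiv> \<lambda>d. d\<^sup>2 * indicator {..4 * r} d"
  assumes g [measurable]: "g \<in> measurable (P n) borel" and "1 \<le> n"
    and med: "AE y in P n. empirical_frechet_median n y (g y)"
    and "0 < r" "0 \<le> \<rho>"
    and T_int: "integrable (P n) (\<lambda>y. T (dist m (g y)))"
    and Bad [measurable]: "Bad \<in> sets (P n)"
    and stable: "\<And>y y' x x' i. y \<in> space (P n) \<Longrightarrow> y \<notin> Bad \<Longrightarrow> i \<in> {1..n} \<Longrightarrow>
      (\<And>j. j \<in> {1..n} \<Longrightarrow> j \<noteq> i \<Longrightarrow> y' j = y j) \<Longrightarrow>
      empirical_frechet_median n y x \<Longrightarrow> empirical_frechet_median n y' x' \<Longrightarrow>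
      dist m x \<le> 4 * r \<Longrightarrow> dist m x' \<le> 4 * r \<Longrightarrow> dist x x' \<le> \<rho>"
    and pos: "\<And>q. 0 \<le> (\<integral>y. (dist y q - dist y m) \<partial>\<nu>)"
    and var: "\<And>q. dist m q \<le> 4 * r \<Longrightarrow> c * (dist m q)\<^sup>2 \<le> (\<integral>y. (dist y q - dist y m) \<partial>\<nu>)"
  shows "c * (\<integral>y. S (dist m (g y)) \<partial>P n)
    \<le> \<rho> + 8 * r * measure (P n) Bad + (\<integral>y. T (dist m (g y)) \<partial>P n) / r"
proof -
  interpret Pn: prob_space "P n" by (rule prob_space_P)
  let ?N = "Suc n"
  interpret PN: prob_space "P ?N" by (rule prob_space_P)
  interpret PP: product_prob_space "\<lambda>_::nat. \<nu>" "{1..n}" by unfold_locales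
  let ?d = "\<lambda>y. dist m (g y)"
  define pr where "pr f y = (\<lambda>j\<in>{1..n}. y (f j))" for f :: "nat \<Rightarrow> nat" and y :: "nat \<Rightarrow> 'a"
  define h where "h f y = sdist (y (f ?N)) (g (pr f y)) - dist (y (f ?N)) m"
    for f :: "nat \<Rightarrow> nat" and y
  define \<sigma> where "\<sigma> i = Transposition.transpose i ?N" for i :: nat
  have \<sigma>: "inj_on (\<sigma> i) A" "\<sigma> i ` {1..?N} \<subseteq> {1..?N}" "\<sigma> i ` {1..n} \<subseteq> {1..?N}" if "i \<in> {1..n}" for i A
    using that by (auto simp: \<sigma>_def inj_on_def Transposition.transpose_def)
  have pr_meas [measurable]: "pr f \<in> measurable (P ?N) (P n)" if "f ` {1..n} \<subseteq> {1..?N}" for f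
    unfolding pr_def using that by (rule measurable_P_reindex)
  have pr_law: "distr (P ?N) (P n) (pr f) = P n" if "inj_on f {1..n}" "f ` {1..n} \<subseteq> {1..?N}" for f
    unfolding pr_def using that by (rule distr_P_reindex)
  have pr_id [measurable]: "pr id \<in> measurable (P ?N) (P n)" by (rule pr_meas) auto
  have pr_\<sigma> [measurable]: "pr (\<sigma> i) \<in> measurable (P ?N) (P n)" if "i \<in> {1..n}" for i
    using \<sigma>(3)[OF that] by (rule pr_meas)
  have lawi: "distr (P ?N) (P n) (pr id) = P n" by (rule pr_law) auto
  have law\<sigma>: "distr (P ?N) (P n) (pr (\<sigma> i)) = P n" if "i \<in> {1..n}" for i
    using \<sigma>[OF that] by (intro pr_law)

  have d_le: "d \<le> 4 * r + T d / (4 * r)" for d :: real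
  proof (cases "d \<le> 4 * r")
    case False
    then have "d * (4 * r) \<le> d * d" using \<open>0 < r\<close> by (intro mult_left_mono) auto
    then have "d \<le> d\<^sup>2 / (4 * r)" using \<open>0 < r\<close> by (simp add: field_simps power2_eq_square)
    then show ?thesis using False \<open>0 < r\<close> by (simp add: T_def)
  qed (simp add: T_def)
  have d_int: "integrable (P n) ?d"
  proof (rule Bochner_Integration.integrable_bound)
    show "integrable (P n) (\<lambda>y. 4 * r + T (?d y) / (4 * r))" using T_int by simp
    show "AE y in P n. norm (?d y) \<le> norm (4 * r + T (?d y) / (4 * r))"
    proof (rule AE_I2)
      fix y
      show "norm (?d y) \<le> norm (4 * r + T (?d y) / (4 * r))"
        using d_le[of "?d y"] zero_le_dist[of m "g y"] by (simp only: real_norm_def abs_of_nonneg)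
    qed
  qed measurable
  have int_pr: "integrable (P ?N) (\<lambda>y. F (pr f y))"
    if "integrable (P n) F" "distr (P ?N) (P n) (pr f) = P n" "pr f \<in> measurable (P ?N) (P n)" for F :: "_ \<Rightarrow> real" and f
    using that integrable_distr[of "pr f" "P ?N" "P n" F] by simp
  have integral_pr: "(\<integral>y. F (pr f y) \<partial>P ?N) = (\<integral>y. F y \<partial>P n)"
    if "F \<in> borel_measurable (P n)" "distr (P ?N) (P n) (pr f) = P n" "pr f \<in> measurable (P ?N) (P n)"
    for F :: "_ \<Rightarrow> real" and f
    using integral_distr[OF that(3,1)] that(2) by simp
  have clos: "AE y in P ?N. \<forall>j\<in>{1..?N}. y j \<in> closure D" by (rule AE_P_closure)
  have h_meas: "h id \<in> borel_measurable (P ?N)"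
    unfolding h_def by measurable
  have h_int: "integrable (P ?N) (h id)"
  proof (rule Bochner_Integration.integrable_bound)
    show "integrable (P ?N) (\<lambda>y. ?d (pr id y))" by (rule int_pr[OF d_int lawi pr_id])
    show "AE y in P ?N. norm (h id y) \<le> norm (?d (pr id y))"
      using clos
    proof eventually_elim
      case (elim y)
      then have "sdist (y ?N) (g (pr id y)) = dist (y ?N) (g (pr id y))" by (simp add: sdist_eq_dist)
      then show ?case
        using dist_triangle[of "y ?N" "g (pr id y)" m] dist_triangle2[of "y ?N" m "g (pr id y)"]
        by (simp add: h_def dist_commute abs_le_iff)
    qed
  qed (rule h_meas)

  \<comment> \<open>exchanging coordinate \<open>i\<close> with the fresh observation\<close>
  have swap: "integrable (P ?N) (h (\<sigma> i))" "(\<integral>y. h (\<sigma> i) y \<partial>P ?N) = (\<integral>y. h id y \<partial>P ?N)"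
    if i: "i \<in> {1..n}" for i
  proof -
    let ?X = "\<lambda>y. \<lambda>j\<in>{1..?N}. y (\<sigma> i j)"
    have X: "?X \<in> measurable (P ?N) (P ?N)" "distr (P ?N) (P ?N) ?X = P ?N"
      by (rule measurable_P_reindex[OF \<sigma>(2)[OF i]] distr_P_reindex[OF \<sigma>(1)[OF i] \<sigma>(2)[OF i]])+
    have hX: "h id (?X y) = h (\<sigma> i) y" for y
    proof -
      have "pr id (?X y) = pr (\<sigma> i) y" by (auto simp: pr_def fun_eq_iff)
      then show ?thesis by (simp add: h_def)
    qed
    show "integrable (P ?N) (h (\<sigma> i))"
      using integrable_distr[OF X(1), of "h id"] h_int X(2) by (simp add: hX)
    show "(\<integral>y. h (\<sigma> i) y \<partial>P ?N) = (\<integral>y. h id y \<partial>P ?N)"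
      using integral_distr[OF X(1) h_meas] X(2) by (simp add: hX)
  qed

  define E where "E i y = \<rho> + 8 * r * indicator Bad (pr id y)
      + (T (?d (pr id y)) + T (?d (pr (\<sigma> i) y))) / (2 * r)" for i y
  have E_int: "integrable (P ?N) (E i)"
    and E_integral: "(\<integral>y. E i y \<partial>P ?N) = \<rho> + 8 * r * measure (P n) Bad + (\<integral>y. T (?d y) \<partial>P n) / r"
    if i: "i \<in> {1..n}" for i
  proof -
    have B: "integrable (P n) (\<lambda>y. indicator Bad y :: real)"
      by (intro integrable_real_indicator) (simp_all add: less_top[symmetric])
    have i1: "integrable (P ?N) (\<lambda>y. indicator Bad (pr id y) :: real)"
      by (rule int_pr[OF B lawi pr_id])
    have i2: "integrable (P ?N) (\<lambda>y. T (?d (pr id y)))"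
      by (rule int_pr[OF T_int lawi pr_id])
    have i3: "integrable (P ?N) (\<lambda>y. T (?d (pr (\<sigma> i) y)))"
      by (rule int_pr[OF T_int law\<sigma>[OF i] pr_\<sigma>[OF i]])
    have e1: "(\<integral>y. indicator Bad (pr id y) \<partial>P ?N) = measure (P n) Bad"
      using integral_pr[OF borel_measurable_integrable[OF B] lawi pr_id]
        sets.sets_into_space[OF Bad] by (simp add: Int_absorb2)
    have e2: "(\<integral>y. T (?d (pr id y)) \<partial>P ?N) = (\<integral>y. T (?d y) \<partial>P n)"
      by (rule integral_pr[OF borel_measurable_integrable[OF T_int] lawi pr_id])
    have e3: "(\<integral>y. T (?d (pr (\<sigma> i) y)) \<partial>P ?N) = (\<integral>y. T (?d y) \<partial>P n)"
      by (rule integral_pr[OF borel_measurable_integrable[OF T_int] law\<sigma>[OF i] pr_\<sigma>[OF i]])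
    show "integrable (P ?N) (E i)" unfolding E_def using i1 i2 i3 by simp
    show "(\<integral>y. E i y \<partial>P ?N) = \<rho> + 8 * r * measure (P n) Bad + (\<integral>y. T (?d y) \<partial>P n) / r"
      unfolding E_def using i1 i2 i3 e1 e2 e3 by (simp add: PN.prob_space)
  qed

  have diff: "dist x x' \<le> E i y"
    if y: "y \<in> space (P ?N)" and i: "i \<in> {1..n}" and x: "x = g (pr id y)" "x' = g (pr (\<sigma> i) y)"
      and m1: "empirical_frechet_median n (pr id y) x" and m2: "empirical_frechet_median n (pr (\<sigma> i) y) x'"
    for y i x x'
  proof -
    have T0: "0 \<le> T d" for d by (simp add: T_def)
    have tri: "dist x x' \<le> dist m x + dist m x'" by (rule dist_triangle3)
    have big: "2 * d \<le> T d / (2 * r)" if "4 * r < d" for d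
    proof -
      have "d * (4 * r) \<le> d * d" using that \<open>0 < r\<close> by (intro mult_left_mono) auto
      then show ?thesis using that \<open>0 < r\<close> by (simp add: T_def field_simps power2_eq_square)
    qed
    have Tr: "0 \<le> T d / (2 * r)" for d using T0 \<open>0 < r\<close> by simp
    have split: "E i y = \<rho> + 8 * r * indicator Bad (pr id y) + T (dist m x) / (2 * r) + T (dist m x') / (2 * r)"
      by (simp add: E_def x add_divide_distrib)
    have ind: "0 \<le> 8 * r * indicator Bad (pr id y)" using \<open>0 < r\<close> by simp
    consider "4 * r < dist m x" "dist m x' \<le> dist m x" | "4 * r < dist m x'" "dist m x \<le> dist m x'"
      | "dist m x \<le> 4 * r" "dist m x' \<le> 4 * r" by linarith
    then show ?thesis
    proof cases
      case 1
      then show ?thesis using big[of "dist m x"] Tr[of "dist m x'"] tri ind \<open>0 \<le> \<rho>\<close> unfolding split by linarith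
    next
      case 2
      then show ?thesis using big[of "dist m x'"] Tr[of "dist m x"] tri ind \<open>0 \<le> \<rho>\<close> unfolding split by linarith
    next
      case 3
      show ?thesis
      proof (cases "pr id y \<in> Bad")
        case True
        then show ?thesis using 3 tri Tr[of "dist m x"] Tr[of "dist m x'"] \<open>0 \<le> \<rho>\<close> unfolding split by simp
      next
        case False
        have "pr id y \<in> space (P n)" using measurable_space[OF pr_id y] .
        moreover have "pr (\<sigma> i) y j = pr id y j" if "j \<in> {1..n}" "j \<noteq> i" for j
          using that by (simp add: pr_def \<sigma>_def Transposition.transpose_def)
        ultimately have "dist x x' \<le> \<rho>"
          using stable[of "pr id y" i "pr (\<sigma> i) y" x x'] False i m1 m2 3 by blast
        then show ?thesis using Tr[of "dist m x"] Tr[of "dist m x'"] ind unfolding split by linarith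
      qed
    qed
  qed

  have sum_le: "AE y in P ?N. (\<Sum>i=1..n. h (\<sigma> i) y) \<le> (\<Sum>i=1..n. E i y)"
  proof -
    have "AE y in P ?N. empirical_frechet_median n (pr id y) (g (pr id y))"
      by (rule AE_distrD[OF pr_id]) (simp only: lawi med)
    moreover have "AE y in P ?N. \<forall>i\<in>{1..n}. empirical_frechet_median n (pr (\<sigma> i) y) (g (pr (\<sigma> i) y))"
    proof (rule AE_finite_allI)
      fix i assume i: "i \<in> {1..n}"
      show "AE y in P ?N. empirical_frechet_median n (pr (\<sigma> i) y) (g (pr (\<sigma> i) y))"
        by (rule AE_distrD[OF pr_\<sigma>[OF i]]) (simp only: law\<sigma>[OF i] med)
    qed simp
    moreover have "AE y in P ?N. y \<in> space (P ?N)" by (rule AE_space)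
    ultimately show ?thesis using clos
    proof eventually_elim
      case (elim y)
      have "h (\<sigma> i) y \<le> (dist (y i) (g (pr id y)) - dist (y i) m) + E i y" if i: "i \<in> {1..n}" for i
      proof -
        have "\<sigma> i ?N = i" by (simp add: \<sigma>_def)
        moreover have "y i \<in> closure D" using elim(4) i by simp
        ultimately have "h (\<sigma> i) y = dist (y i) (g (pr (\<sigma> i) y)) - dist (y i) m"
          by (simp add: h_def sdist_eq_dist)
        then show ?thesis
          using diff[OF elim(3) i refl refl elim(1)] elim(2) i
            dist_triangle[of "y i" "g (pr (\<sigma> i) y)" "g (pr id y)"] by fastforce
      qed
      then have "(\<Sum>i=1..n. h (\<sigma> i) y) \<le> (\<Sum>i=1..n. (dist (y i) (g (pr id y)) - dist (y i) m) + E i y)"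
        by (intro sum_mono) auto
      also have "\<dots> = ((\<Sum>i=1..n. dist (pr id y i) (g (pr id y))) - (\<Sum>i=1..n. dist (pr id y i) m)) + (\<Sum>i=1..n. E i y)"
        by (simp add: sum.distrib sum_subtractf pr_def)
      also have "\<dots> \<le> (\<Sum>i=1..n. E i y)"
        using elim(1) by (simp add: empirical_frechet_median_iff)
      finally show ?case .
    qed
  qed
  define U where "U = \<rho> + 8 * r * measure (P n) Bad + (\<integral>y. T (?d y) \<partial>P n) / r"
  have "real n * (\<integral>y. h id y \<partial>P ?N) = (\<Sum>i=1..n. \<integral>y. h (\<sigma> i) y \<partial>P ?N)"
    using swap(2) by simp
  also have "\<dots> = (\<integral>y. (\<Sum>i=1..n. h (\<sigma> i) y) \<partial>P ?N)"
    using swap(1) by (intro Bochner_Integration.integral_sum[symmetric])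
  also have "\<dots> \<le> (\<integral>y. (\<Sum>i=1..n. E i y) \<partial>P ?N)"
    by (intro integral_mono_AE Bochner_Integration.integrable_sum swap(1) E_int sum_le)
  also have "\<dots> = (\<Sum>i=1..n. \<integral>y. E i y \<partial>P ?N)"
    using E_int by (intro Bochner_Integration.integral_sum)
  also have "\<dots> = real n * U"
    using E_integral by (simp add: U_def)
  finally have upper: "(\<integral>y. h id y \<partial>P ?N) \<le> U"
    using \<open>1 \<le> n\<close> by (simp add: mult_le_cancel_left_pos)

  have ins: "{1..?N} = insert ?N {1..n}" by auto
  have fubini: "(\<integral>y. h id y \<partial>P ?N) = (\<integral>x. (\<integral>y. h id (x(?N := y)) \<partial>\<nu>) \<partial>P n)"
    unfolding ins by (rule PP.product_integral_insert) (use h_int ins in auto)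
  have inner: "(\<integral>y. h id (x(?N := y)) \<partial>\<nu>) = (\<integral>y. sdist y (g x) - dist y m \<partial>\<nu>)"
    if "x \<in> space (P n)" for x
  proof -
    have "pr id (x(?N := y)) = x" for y
      using that by (auto simp: pr_def fun_eq_iff space_PiM PiE_iff extensional_def)
    then show ?thesis by (simp add: h_def)
  qed
  have risk: "(\<integral>y. sdist y q - dist y m \<partial>\<nu>) = (\<integral>y. dist y q - dist y m \<partial>\<nu>)" for q
    by (rule integral_cong_AE) (measurable, use AE_closure_D in \<open>eventually_elim, simp add: sdist_eq_dist\<close>)
  let ?F = "\<lambda>x. \<integral>y. sdist y (g x) - dist y m \<partial>\<nu>"
  have F_meas: "?F \<in> borel_measurable (P n)" by measurable
  have F_int: "integrable (P n) ?F"
  proof (rule Bochner_Integration.integrable_bound[OF d_int F_meas], rule AE_I2)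
    fix x
    have "(\<integral>y. dist y (g x) - dist y m \<partial>\<nu>) \<le> (\<integral>y. ?d x \<partial>\<nu>)"
      using integrable_dist_diff[of "g x" m]
    proof (rule integral_mono)
      fix y show "dist y (g x) - dist y m \<le> ?d x" using dist_triangle[of y "g x" m] by simp
    qed simp
    then show "norm (?F x) \<le> norm (?d x)"
      using pos[of "g x"] by (simp add: risk prob_space[simplified])
  qed
  have S_int: "integrable (P n) (\<lambda>x. S (?d x))"
  proof (rule Pn.integrable_const_bound[of _ "(4 * r)\<^sup>2"])
    have "norm (S d) \<le> (4 * r)\<^sup>2" if "0 \<le> d" for d
      using that \<open>0 < r\<close> power_mono[of d "4 * r" 2] by (cases "d \<le> 4 * r") (simp_all add: S_def)
    then show "AE x in P n. norm (S (?d x)) \<le> (4 * r)\<^sup>2" by (intro AE_I2) simp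
  qed (simp add: S_def)
  have "c * (\<integral>x. S (?d x) \<partial>P n) = (\<integral>x. c * S (?d x) \<partial>P n)" by simp
  also have "\<dots> \<le> (\<integral>x. ?F x \<partial>P n)"
  proof (rule integral_mono[OF _ F_int])
    fix x show "c * S (?d x) \<le> ?F x"
      using pos[of "g x"] var[of "g x"] by (auto simp: S_def risk indicator_def)
  qed (use S_int in simp)
  also have "\<dots> = (\<integral>y. h id y \<partial>P ?N)"
    unfolding fubini by (rule Bochner_Integration.integral_cong[OF refl inner[symmetric]])
  finally show ?thesis using upper by (simp add: U_def)
qed

section \<open>The rate for the product law\<close>

text \<open>
Each block in \<open>A\<close> contributes at least one index with \<open>Q\<close>, and the blocks are disjoint parts of
\<open>{1..n}\<close>.
\<close>

lemma block_count_le: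
  fixes K l n :: nat
  assumes hits: "\<And>z. z \<in> A \<Longrightarrow> \<exists>j\<in>{1..l}. Q (z j)" and "K * l \<le> n"
  shows "(\<Sum>b<K. indicator A (\<lambda>j\<in>{1..l}. y (b * l + j))) \<le> (\<Sum>j=1..n. of_bool (Q (y j)) :: real)"
proof -
  have "(\<Sum>b<K. indicator A (\<lambda>j\<in>{1..l}. y (b * l + j))) \<le> (\<Sum>b<K. \<Sum>j=1..l. of_bool (Q (y (b * l + j))) :: real)"
  proof (rule sum_mono)
    fix b
    show "indicator A (\<lambda>j\<in>{1..l}. y (b * l + j)) \<le> (\<Sum>j=1..l. of_bool (Q (y (b * l + j))) :: real)"
    proof (cases "(\<lambda>j\<in>{1..l}. y (b * l + j)) \<in> A")
      case True
      then obtain j where j: "j \<in> {1..l}" "Q (y (b * l + j))" using hits by fastforce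
      then have "(1::real) \<le> of_bool (Q (y (b * l + j)))" by simp
      also have "\<dots> \<le> (\<Sum>j=1..l. of_bool (Q (y (b * l + j))))"
        by (rule member_le_sum[OF j(1), of "\<lambda>j. of_bool (Q (y (b * l + j)))"]) auto
      finally show ?thesis using True by simp
    qed (simp add: sum_nonneg)
  qed
  also have "\<dots> = (\<Sum>t=1..K * l. of_bool (Q (y t)))"
  proof (induction K)
    case (Suc K)
    have "(\<Sum>t=1..Suc K * l. of_bool (Q (y t)) :: real)
        = (\<Sum>t=1..K * l. of_bool (Q (y t))) + (\<Sum>t=K * l + 1..K * l + l. of_bool (Q (y t)))"
      using sum.ub_add_nat[of 1 "K * l" "\<lambda>t. of_bool (Q (y t)) :: real" l] by (simp add: add.commute)
    also have "(\<Sum>t=K * l + 1..K * l + l. of_bool (Q (y t)) :: real) = (\<Sum>j=1..l. of_bool (Q (y (K * l + j))))"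
      using sum.shift_bounds_cl_nat_ivl[of "\<lambda>t. of_bool (Q (y t)) :: real" 1 "K * l" l] by (simp add: add.commute)
    finally show ?case using Suc by simp
  qed simp
  also have "\<dots> \<le> (\<Sum>t=1..n. of_bool (Q (y t)))"
    using \<open>K * l \<le> n\<close> by (intro sum_mono2) auto
  finally show ?thesis .
qed

lemma markov_tail:
  assumes int: "integrable \<nu> (\<lambda>y. dist y m powr \<xi>)" and "0 < \<xi>" "0 < s"
  shows "prob {y. s < dist y m} \<le> (\<integral>y. dist y m powr \<xi> \<partial>\<nu>) * s powr (- \<xi>)"
proof -
  have "{y\<in>space \<nu>. s < dist y m} \<in> events" by measurable
  have "prob {y. s < dist y m} \<le> prob {y\<in>space \<nu>. s powr \<xi> \<le> dist y m powr \<xi>}"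
  proof (rule finite_measure_mono)
    show "{y. s < dist y m} \<subseteq> {y\<in>space \<nu>. s powr \<xi> \<le> dist y m powr \<xi>}"
      using \<open>0 < \<xi>\<close> \<open>0 < s\<close> by (auto intro!: powr_mono2)
  qed measurable
  also have "\<dots> \<le> (\<integral>y. dist y m powr \<xi> \<partial>\<nu>) / s powr \<xi>"
    using \<open>0 < s\<close> by (intro integral_Markov_inequality_measure[where A = "{}"] int) auto
  finally show ?thesis by (simp add: powr_minus divide_inverse)
qed

text \<open>
With \<open>K = n div l\<close> blocks, all but an exponentially small part of the samples have at least
\<open>K * p / 2\<close> observations outside any given bow tie with knots in the ball. Then \<open>median_replace_one\<close>
gives stability with \<open>\<rho>\<close> of order \<open>1 / n\<close>, and \<open>expected_excess_of_stable_median\<close> bounds the second moment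
inside the ball of radius \<open>4 * r\<close>. The part outside is \<open>second_moment_of_light_tails\<close>
applied to \<open>median_tail\<close>.
\<close>

lemma median_mean_square_rate:
  fixes g :: "nat \<Rightarrow> (nat \<Rightarrow> 'a) \<Rightarrow> 'a" and m :: 'a and r w \<xi> c :: real
  assumes g [measurable]: "\<And>n. 1 \<le> n \<Longrightarrow> g n \<in> measurable (P n) borel"
    and med: "\<And>n. 1 \<le> n \<Longrightarrow> AE y in P n. empirical_frechet_median n y (g n y)"
    and "0 < r" "0 < w" "0 < \<xi>" and int: "integrable \<nu> (\<lambda>y. dist y m powr \<xi>)"
    and far: "prob {y. r < dist y m} < 1 / 27" and R: "4 * r \<le> R"
    and pos: "\<And>q. 0 \<le> (\<integral>y. (dist y q - dist y m) \<partial>\<nu>)"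
    and "0 < c" and var: "\<And>q. dist m q \<le> R \<Longrightarrow> c * (dist m q)\<^sup>2 \<le> (\<integral>y. (dist y q - dist y m) \<partial>\<nu>)"
    and A [measurable]: "A \<in> sets (P l)" and "1 \<le> l" and A_pos: "0 < measure (P l) A"
    and hits: "\<And>z q p. z \<in> A \<Longrightarrow> dist m q \<le> R \<Longrightarrow> dist m p \<le> R \<Longrightarrow>
      \<exists>j\<in>{1..l}. z j \<notin> bow_tie q p w \<and> dist (z j) m \<le> R"
  shows "\<exists>C n0. \<forall>n\<ge>n0. (\<integral>\<^sup>+y. ennreal ((dist m (g n y))\<^sup>2) \<partial>P n) \<le> ennreal (C / real n)"
proof -
  have "0 < R" using R \<open>0 < r\<close> by linarith
  define T where "T d = d\<^sup>2 * indicator {4 * r<..} d" for d :: real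
  define S where "S d = d\<^sup>2 * indicator {..4 * r} d" for d :: real
  have TS: "d\<^sup>2 = T d + S d" "0 \<le> T d" "0 \<le> S d" for d
    by (auto simp: T_def S_def indicator_def)
  have far_mono: "prob {y. s < dist y m} \<le> 1 / 27" if "r \<le> s" for s
  proof -
    have "{y\<in>space \<nu>. r < dist y m} \<in> events" by measurable
    then have "prob {y. s < dist y m} \<le> prob {y. r < dist y m}"
      using that by (intro finite_measure_mono) auto
    then show ?thesis using far by simp
  qed
  obtain C3 n3 where "0 \<le> C3" "1 \<le> n3" and C3: "\<And>n. n3 \<le> n \<Longrightarrow>
      (\<integral>\<^sup>+y. ennreal (T (dist m (g n y))) \<partial>P n) \<le> ennreal (C3 / real n)"
  proof -
    have "\<exists>C n0. 0 \<le> C \<and> 1 \<le> n0 \<and> (\<forall>n\<ge>n0.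
        (\<integral>\<^sup>+y. ennreal ((dist m (g n y))\<^sup>2 * indicator {4 * r<..} (dist m (g n y))) \<partial>P n) \<le> ennreal (C / real n))"
    proof (rule second_moment_of_light_tails[OF _ \<open>0 < r\<close> \<open>0 < \<xi>\<close>])
      fix s assume "r \<le> s"
      then show "prob {y. s < dist y m} \<le> (\<integral>y. dist y m powr \<xi> \<partial>\<nu>) * s powr (- \<xi>)"
        using \<open>0 < r\<close> by (intro markov_tail int \<open>0 < \<xi>\<close>) auto
    next
      fix n :: nat and s assume "1 \<le> n"
      then show "emeasure (P n) {x\<in>space (P n). 4 * s < dist m (g n x)}
          \<le> ennreal ((8 * prob {y. s < dist y m}) ^ ((n + 2) div 3))"
        by (intro median_tail g med)
    qed (use far_mono in auto)
    then show ?thesis using that unfolding T_def by blast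
  qed
  define p where "p = measure (P l) A"
  have "0 < p" using A_pos by (simp add: p_def)
  \<comment> \<open>contributions of \<open>\<rho>\<close>, of the samples with few good blocks, and of the median far away,
    each rescaled with \<open>1 / K \<le> 2 * l / n\<close>\<close>
  define C4 where "C4 = 64 * R * real l / (p * w\<^sup>2) + 32 * r * real l / p\<^sup>2 + C3 / r"
  have "(\<integral>\<^sup>+y. ennreal ((dist m (g n y))\<^sup>2) \<partial>P n) \<le> ennreal ((C4 / c + C3) / real n)"
    if n: "max n3 l \<le> n" for n
  proof -
    interpret Pn: prob_space "P n" by (rule prob_space_P)
    have "1 \<le> n" using n \<open>1 \<le> n3\<close> by simp
    note [measurable] = g[OF \<open>1 \<le> n\<close>]
    let ?d = "\<lambda>y. dist m (g n y)"
    define K where "K = n div l"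
    have "K * l \<le> n" by (simp add: K_def)
    have "0 < K" using n \<open>1 \<le> l\<close> by (simp add: K_def div_greater_zero_iff)
    have "n < Suc K * l" unfolding K_def using \<open>1 \<le> l\<close> dividend_less_div_times[of l n] by (simp add: algebra_simps)
    also have "\<dots> \<le> 2 * K * l" using \<open>0 < K\<close> by simp
    finally have "real n \<le> real (2 * K * l)" by (simp only: of_nat_le_iff less_imp_le)
    then have Kn: "1 / real K \<le> 2 * real l / real n"
      using \<open>0 < K\<close> \<open>1 \<le> n\<close> by (simp add: field_simps)
    define Bad where "Bad = {y\<in>space (P n). (\<Sum>b<K. indicator A (\<lambda>j\<in>{1..l}. y (b * l + j))) \<le> real K * p / 2}"
    have Bad: "Bad \<in> sets (P n)" "measure (P n) Bad \<le> exp (- (real K * p\<^sup>2 / 2))"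
      unfolding Bad_def p_def using block_hits_concentration[OF A \<open>0 < K\<close> \<open>K * l \<le> n\<close> \<open>1 \<le> n\<close>] by blast+
    define \<rho> where "\<rho> = 16 * R / (real K * p / 2 * w\<^sup>2)"
    have T_meas: "(\<lambda>y. T (?d y)) \<in> borel_measurable (P n)" "(\<lambda>y. S (?d y)) \<in> borel_measurable (P n)"
      unfolding T_def S_def by measurable
    have T_nn: "(\<integral>\<^sup>+y. ennreal (T (?d y)) \<partial>P n) \<le> ennreal (C3 / real n)" using C3 n by simp
    have T_int: "integrable (P n) (\<lambda>y. T (?d y))"
      using T_nn by (intro integrableI_nonneg T_meas) (auto simp: TS intro: le_less_trans)
    have T_bound: "(\<integral>y. T (?d y) \<partial>P n) \<le> C3 / real n"
      using T_nn \<open>0 \<le> C3\<close> nn_integral_eq_integral[OF T_int] by (simp add: TS ennreal_le_iff)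
    have stable: "dist x x' \<le> \<rho>"
      if y: "y \<in> space (P n)" "y \<notin> Bad" and i: "i \<in> {1..n}" and y': "\<And>j. j \<in> {1..n} \<Longrightarrow> j \<noteq> i \<Longrightarrow> y' j = y j"
        and x: "empirical_frechet_median n y x" "empirical_frechet_median n y' x'"
        and near: "dist m x \<le> 4 * r" "dist m x' \<le> 4 * r" for y y' x x' i
    proof -
      have near': "dist m x \<le> R" "dist m x' \<le> R" using near R by auto
      have "real K * p / 2 \<le> (\<Sum>b<K. indicator A (\<lambda>j\<in>{1..l}. y (b * l + j)))"
        using y by (simp add: Bad_def)
      also have "\<dots> \<le> (\<Sum>j=1..n. of_bool (y j \<notin> bow_tie x x' w \<and> dist (y j) m \<le> R))"
        by (rule block_count_le[OF _ \<open>K * l \<le> n\<close>]) (rule hits[OF _ near'])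
      finally have many: "real K * p / 2 \<le> (\<Sum>j=1..n. of_bool (y j \<notin> bow_tie x x' w \<and> dist (y j) m \<le> R))" .
      show ?thesis unfolding \<rho>_def
        using median_replace_one[OF x i y' near' \<open>0 < R\<close> _ \<open>0 < w\<close> many] \<open>0 < K\<close> \<open>0 < p\<close> by simp
    qed
    have "0 \<le> \<rho>" using \<open>0 < R\<close> \<open>0 < p\<close> by (simp add: \<rho>_def)
    have "c * (\<integral>y. S (?d y) \<partial>P n) \<le> \<rho> + 8 * r * measure (P n) Bad + (\<integral>y. T (?d y) \<partial>P n) / r"
      unfolding S_def T_def
    proof (rule expected_excess_of_stable_median[OF g[OF \<open>1 \<le> n\<close>] \<open>1 \<le> n\<close> med[OF \<open>1 \<le> n\<close>]
          \<open>0 < r\<close> \<open>0 \<le> \<rho>\<close> T_int[unfolded T_def] Bad(1) _ pos])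
      fix q assume "dist m q \<le> 4 * r"
      with R show "c * (dist m q)\<^sup>2 \<le> (\<integral>y. (dist y q - dist y m) \<partial>\<nu>)" by (intro var) simp
    next
      fix y y' x x' i
      assume a: "y \<in> space (P n)" "y \<notin> Bad" "i \<in> {1..n}"
        "\<And>j. j \<in> {1..n} \<Longrightarrow> j \<noteq> i \<Longrightarrow> y' j = y j"
        "empirical_frechet_median n y x" "empirical_frechet_median n y' x'"
        "dist m x \<le> 4 * r" "dist m x' \<le> 4 * r"
      show "dist x x' \<le> \<rho>" by (rule stable[OF a])
    qed
    also have "\<dots> \<le> C4 / real n"
    proof -
      have "\<rho> = 32 * R / (p * w\<^sup>2) * (1 / real K)" using \<open>0 < K\<close> \<open>0 < p\<close> by (simp add: \<rho>_def)
      also have "\<dots> \<le> 32 * R / (p * w\<^sup>2) * (2 * real l / real n)"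
        using \<open>0 < R\<close> \<open>0 < p\<close> by (intro mult_left_mono Kn) auto
      finally have 1: "\<rho> \<le> 64 * R * real l / (p * w\<^sup>2) / real n" by (simp add: field_simps)
      have "measure (P n) Bad \<le> 1 / (real K * p\<^sup>2 / 2)"
      proof -
        have "exp (- u) \<le> 1 / u" if "0 < u" for u :: real
        proof -
          have "u \<le> exp u" using exp_ge_add_one_self[of u] by linarith
          then show ?thesis unfolding exp_minus inverse_eq_divide
            using that by (intro divide_left_mono) auto
        qed
        from this[of "real K * p\<^sup>2 / 2"] have "exp (- (real K * p\<^sup>2 / 2)) \<le> 1 / (real K * p\<^sup>2 / 2)"
          using \<open>0 < K\<close> \<open>0 < p\<close> by simp
        with Bad(2) show ?thesis by linarith
      qed
      also have "\<dots> = 2 / p\<^sup>2 * (1 / real K)" by simp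
      also have "\<dots> \<le> 2 / p\<^sup>2 * (2 * real l / real n)" by (intro mult_left_mono Kn) auto
      finally have "8 * r * measure (P n) Bad \<le> 8 * r * (2 / p\<^sup>2 * (2 * real l / real n))"
        using \<open>0 < r\<close> by (intro mult_left_mono) auto
      then have 2: "8 * r * measure (P n) Bad \<le> 32 * r * real l / p\<^sup>2 / real n" by simp
      have 3: "(\<integral>y. T (?d y) \<partial>P n) / r \<le> C3 / r / real n"
        using divide_right_mono[OF T_bound, of r] \<open>0 < r\<close> by (simp add: mult.commute)
      from 1 2 3 show ?thesis by (simp add: C4_def add_divide_distrib)
    qed
    finally have "(\<integral>y. S (?d y) \<partial>P n) \<le> C4 / c / real n"
      using \<open>0 < c\<close> \<open>1 \<le> n\<close> by (simp add: field_simps)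
    moreover have S_int: "integrable (P n) (\<lambda>y. S (?d y))"
    proof (rule Pn.integrable_const_bound[OF _ T_meas(2)])
      have "norm (S d) \<le> (4 * r)\<^sup>2" if "0 \<le> d" for d
        using that \<open>0 < r\<close> power_mono[of d "4 * r" 2] by (cases "d \<le> 4 * r") (simp_all add: S_def)
      then show "AE y in P n. norm (S (?d y)) \<le> (4 * r)\<^sup>2" by (intro AE_I2) simp
    qed
    ultimately have S_nn: "(\<integral>\<^sup>+y. ennreal (S (?d y)) \<partial>P n) \<le> ennreal (C4 / c / real n)"
      using nn_integral_eq_integral[OF S_int] by (simp add: TS ennreal_leI)
    have "0 \<le> C4" using \<open>0 < R\<close> \<open>0 < p\<close> \<open>0 < r\<close> \<open>0 \<le> C3\<close> by (simp add: C4_def)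
    have "(\<integral>\<^sup>+y. ennreal ((?d y)\<^sup>2) \<partial>P n) = (\<integral>\<^sup>+y. ennreal (T (?d y)) + ennreal (S (?d y)) \<partial>P n)"
      by (subst TS(1)) (simp add: TS ennreal_plus)
    also have "\<dots> = (\<integral>\<^sup>+y. ennreal (T (?d y)) \<partial>P n) + (\<integral>\<^sup>+y. ennreal (S (?d y)) \<partial>P n)"
      using T_meas by (intro nn_integral_add) auto
    also have "\<dots> \<le> ennreal (C3 / real n) + ennreal (C4 / c / real n)"
      by (intro add_mono T_nn S_nn)
    also have "\<dots> = ennreal ((C4 / c + C3) / real n)"
      using \<open>0 \<le> C3\<close> \<open>0 \<le> C4\<close> \<open>0 < c\<close> by (simp add: add_divide_distrib add.commute flip: ennreal_plus)
    finally show ?thesis .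
  qed
  then show ?thesis by blast
qed

end

section \<open>From the product law to the sample\<close>

lemma exists_countable_dense_of_separable:
  assumes "separable_space (top_of_set S)"
  shows "\<exists>C. countable C \<and> C \<subseteq> S \<and> S \<subseteq> closure C"
proof -
  obtain C where C: "countable C" "C \<subseteq> S" "top_of_set S closure_of C = S"
    using assms unfolding separable_space_def by auto
  then have "S \<inter> closure (S \<inter> C) = S"
    by (simp add: closure_of_subtopology)
  with C show ?thesis by (metis inf.absorb2 inf.absorb_iff1)
qed

text \<open>
A uniform statement about all knots need not define a measurable set of samples, but the infimum of
the counts is measurable for the completed law. It takes values in the multiples of \<open>1 / l\<close>, so it is
attained and vanishes only if some pair of knots catches the whole block. Its positivity set
differs by a null set from a measurable subset \<open>A\<close>, on which every pair of knots misses an observation.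
\<close>

lemma pos_measure_block:
  fixes P :: "'b measure" and V :: "'b \<Rightarrow> nat \<Rightarrow> 'c \<Rightarrow> 'd \<Rightarrow> bool"
  assumes "prob_space P" and X: "X \<in> measurable M P" "distr M P X = P"
    and B: "B \<noteq> {}" and l: "0 < l"
    and meas: "(\<lambda>y. INF (q, p)\<in>B. (1 / real l) * (\<Sum>j=1..l. of_bool (V y j q p))) \<in> borel_measurable (completion P)"
    and not_all: "\<not> (AE \<omega> in M. \<exists>(q, p)\<in>B. \<forall>j\<in>{1..l}. \<not> V (X \<omega>) j q p)"
  shows "\<exists>A\<in>sets P. 0 < measure P A \<and> (\<forall>y\<in>A. \<forall>(q, p)\<in>B. \<exists>j\<in>{1..l}. V y j q p)"
proof -
  interpret P: prob_space P by fact
  let ?val = "\<lambda>y q p. (1 / real l) * (\<Sum>j=1..l. of_bool (V y j q p))"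
  let ?I = "\<lambda>y. INF (q, p)\<in>B. ?val y q p"
  have bdd: "bdd_below ((\<lambda>(q, p). ?val y q p) ` B)" for y
    by (rule bdd_belowI[of _ 0]) (auto intro!: divide_nonneg_nonneg sum_nonneg)
  have attained: "\<exists>(q, p)\<in>B. \<forall>j\<in>{1..l}. \<not> V y j q p" if "?I y \<le> 0" for y
  proof (rule ccontr)
    assume none: "\<not> ?thesis"
    have "1 / real l \<le> ?I y"
    proof (rule cINF_greatest[OF B], clarify)
      fix q p assume "(q, p) \<in> B"
      with none obtain j where j: "j \<in> {1..l}" "V y j q p" by blast
      have "(1::real) = of_bool (V y j q p)" using j by simp
      also have "\<dots> \<le> (\<Sum>j=1..l. of_bool (V y j q p))"
        by (rule member_le_sum[OF j(1), of "\<lambda>j. of_bool (V y j q p)"]) auto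
      finally show "1 / real l \<le> ?val y q p" using l by (simp add: field_simps)
    qed
    moreover have "0 < 1 / real l" using l by simp
    ultimately show False using that by linarith
  qed
  define G where "G = {y\<in>space (completion P). 0 < ?I y}"
  have G: "G \<in> sets (completion P)" unfolding G_def using meas by measurable
  define A where "A = main_part P G"
  have A: "A \<in> sets P" "A \<subseteq> G"
    using main_part_sets[OF G] main_part_null_part_Un[OF G] by (auto simp: A_def)
  have hits: "\<exists>j\<in>{1..l}. V y j q p" if "y \<in> A" "(q, p) \<in> B" for y q p
  proof (rule ccontr)
    assume "\<not> ?thesis"
    then have "?val y q p = 0" by simp
    moreover have "?I y \<le> ?val y q p" using cINF_lower[OF bdd that(2)] by simp
    moreover have "0 < ?I y" using that(1) A(2) by (auto simp: G_def)
    ultimately show False by linarith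
  qed
  have "measure P A \<noteq> 0"
  proof
    assume "measure P A = 0"
    then have "G \<in> null_sets (completion P)"
      using G by (intro null_setsI) (simp_all add: A_def P.emeasure_eq_measure)
    then have "AE y in completion P. y \<notin> G" by (rule AE_not_in)
    then have "AE y in distr M P X. y \<notin> G" unfolding X(2) AE_completion_iff .
    then have "AE \<omega> in M. X \<omega> \<notin> G" by (rule AE_distrD[OF X(1)])
    then have "AE \<omega> in M. \<exists>(q, p)\<in>B. \<forall>j\<in>{1..l}. \<not> V (X \<omega>) j q p"
    proof (rule AE_mp, intro AE_I2 impI)
      fix \<omega> assume "\<omega> \<in> space M" "X \<omega> \<notin> G"
      then have "?I (X \<omega>) \<le> 0" using measurable_space[OF X(1)] by (simp add: G_def not_less)
      then show "\<exists>(q, p)\<in>B. \<forall>j\<in>{1..l}. \<not> V (X \<omega>) j q p" by (rule attained)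
    qed
    with not_all show False by contradiction
  qed
  then have "0 < measure P A" by (simp add: zero_less_measure_iff)
  with A(1) hits show ?thesis by (intro bexI[of _ A]) auto
qed

theorem theorem4p15:
  fixes M :: "'w measure"
    and Y :: "'w \<Rightarrow> 'a::hadamard_space"
    and Ys :: "nat \<Rightarrow> 'w \<Rightarrow> 'a"
    and med :: "nat \<Rightarrow> (nat \<Rightarrow> 'a) \<Rightarrow> 'a"
    and m :: 'a
    and \<xi> r R w :: real
    and l :: nat
  assumes "prob_space M"
    and "Y \<in> measurable M borel"
    and "\<exists>S. separable_space (top_of_set S) \<and> measure M {\<omega>\<in>space M. Y \<omega> \<in> S} = 1"
    and "frechet_median M Y m"
    \<comment> \<open>\<open>Ys 1, Ys 2, \<dots>\<close> are independent copies of \<open>Y\<close>\<close>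
    and "prob_space.indep_vars M (\<lambda>_. borel) Ys {1..}"
    and "\<And>j. j \<ge> 1 \<Longrightarrow> distr M borel (Ys j) = distr M borel Y"
    \<comment> \<open>the empirical median is a measurable function of the sample\<close>
    and "\<And>n. n \<ge> 1 \<Longrightarrow> med n \<in> measurable (PiM {1..n} (\<lambda>_. borel)) borel"
    and "\<And>n \<omega>. n \<ge> 1 \<Longrightarrow> \<omega> \<in> space M \<Longrightarrow>
           empirical_frechet_median n (\<lambda>j. Ys j \<omega>) (med n (\<lambda>j\<in>{1..n}. Ys j \<omega>))"
    and "\<xi> > 0"
    and "integrable M (\<lambda>\<omega>. dist (Y \<omega>) m powr \<xi>)"
    and "r > 0"
    and "measure M {\<omega>\<in>space M. dist (Y \<omega>) m > r} < 1 / 27"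
    and "R = 6 * r"
    and "0 < w" and "w \<le> 1"
    and "(SUP p\<in>cball m R. measure M {\<omega>\<in>space M. Y \<omega> \<in> bow_tie m p w}) < 1"
    and "measure M {\<omega>\<in>space M. \<exists>q\<in>cball m R. \<exists>p\<in>cball m R.
           \<forall>j\<in>{1..l}. Ys j \<omega> \<in> bow_tie q p w \<union> (UNIV - cball m R)} < 1"
    \<comment> \<open>measurability convention; the infimum is a function of the sample,
      measurable up to null sets of the law of the sample\<close>
    and "{\<omega>\<in>space M. \<exists>q\<in>cball m R. \<exists>p\<in>cball m R.
           \<forall>j\<in>{1..l}. Ys j \<omega> \<in> bow_tie q p w \<union> (UNIV - cball m R)} \<in> sets M"
    and "\<And>n. n \<ge> 1 \<Longrightarrow>
           (\<lambda>y. INF (q, p)\<in>cball m R \<times> cball m R.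
              (1 / real n) * (\<Sum>j=1..n. of_bool (y j \<notin> bow_tie q p w \<and> dist (y j) m \<le> R)))
           \<in> borel_measurable (completion (PiM {1..n} (\<lambda>_. distr M borel Y)))"
  shows "\<exists>C n0. \<forall>n\<ge>n0.
           (\<integral>\<^sup>+\<omega>. ennreal ((dist m (med n (\<lambda>j\<in>{1..n}. Ys j \<omega>)))\<^sup>2) \<partial>M) \<le> ennreal (C / real n)"
proof -
  interpret prob_space M by fact
  note [measurable] = assms(2)
  have "0 < R" using assms(11,13) by simp
  let ?E = "{\<omega>\<in>space M. \<exists>q\<in>cball m R. \<exists>p\<in>cball m R.
           \<forall>j\<in>{1..l}. Ys j \<omega> \<in> bow_tie q p w \<union> (UNIV - cball m R)}"
  define \<nu> where "\<nu> = distr M borel Y"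
  have sets_\<nu> [measurable_cong]: "sets \<nu> = sets borel" by (simp add: \<nu>_def)
  interpret law: prob_space \<nu> unfolding \<nu>_def by (rule prob_space_distr) measurable

  obtain S where S: "separable_space (top_of_set S)" "prob {\<omega>\<in>space M. Y \<omega> \<in> S} = 1"
    using assms(3) by blast
  then obtain D where D: "countable D" "D \<subseteq> S" "S \<subseteq> closure D"
    using exists_countable_dense_of_separable by blast
  have "D \<noteq> {}"
  proof
    assume "D = {}"
    then have empty: "{\<omega>\<in>space M. Y \<omega> \<in> S} = {}" using D by auto
    show False using S(2) unfolding empty by simp
  qed
  have AE_D: "AE y in \<nu>. y \<in> closure D"
  proof -
    have ev: "{\<omega>\<in>space M. Y \<omega> \<in> S} \<in> events" using S(2) measure_notin_sets by fastforce
    have "AE \<omega> in M. Y \<omega> \<in> S" by (rule iffD1[OF prob_Collect_eq_1[OF ev] S(2)])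
    then have "AE \<omega> in M. Y \<omega> \<in> closure D" by eventually_elim (use D in auto)
    then show ?thesis unfolding \<nu>_def by (subst AE_distr_iff) simp_all
  qed
  interpret L: separable_law \<nu> D
    by unfold_locales (use D \<open>D \<noteq> {}\<close> AE_D sets_\<nu> in auto)

  have sets_P: "sets (L.P n) = sets (PiM {1..n} (\<lambda>_. borel))" for n
    by (intro sets_PiM_cong refl sets_\<nu>)
  define X where "X n \<omega> = (\<lambda>j\<in>{1..n}. Ys j \<omega>)" for n \<omega>
  have Ys: "Ys j \<in> measurable M borel" if "1 \<le> j" for j
    using assms(5) that by (auto simp: indep_vars_def)
  have X_meas: "X n \<in> measurable M (L.P n)" for n
    unfolding X_def by (intro measurable_restrict) (use Ys sets_\<nu> in \<open>simp cong: measurable_cong_sets\<close>)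
  have X_law: "distr M (L.P n) (X n) = L.P n" if n: "1 \<le> n" for n
  proof -
    have "indep_vars (\<lambda>_. borel) Ys {1..n}"
      by (rule indep_vars_subset[OF assms(5)]) auto
    then have "distr M (PiM {1..n} (\<lambda>_. borel)) (X n) = PiM {1..n} (\<lambda>i. distr M borel (Ys i))"
      using n Ys unfolding X_def by (subst (asm) indep_vars_iff_distr_eq_PiM') auto
    moreover have "PiM {1..n} (\<lambda>i. distr M borel (Ys i)) = L.P n"
      unfolding \<nu>_def by (intro PiM_cong refl assms(6)) simp
    moreover have "distr M (PiM {1..n} (\<lambda>_. borel)) (X n) = distr M (L.P n) (X n)"
      by (intro distr_cong refl sets_P[symmetric])
    ultimately show ?thesis by simp
  qed
  have med_meas: "med n \<in> measurable (L.P n) borel" if "1 \<le> n" for n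
    using assms(7)[OF that] measurable_cong_sets[OF sets_P refl] by blast
  have med_opt: "AE y in L.P n. empirical_frechet_median n y (med n y)" if n: "1 \<le> n" for n
  proof (rule L.AE_empirical_median[OF med_meas[OF n] X_meas X_law[OF n]])
    fix \<omega> assume "\<omega> \<in> space M"
    from assms(8)[OF n this] show "empirical_frechet_median n (X n \<omega>) (med n (X n \<omega>))"
      by (simp add: empirical_frechet_median_iff X_def)
  qed

  have risk: "(\<integral>y. (dist y q - dist y m) \<partial>\<nu>) = (\<integral>\<omega>. (dist (Y \<omega>) q - dist (Y \<omega>) m) \<partial>M)" for q
    unfolding \<nu>_def by (rule integral_distr) measurable
  have pos: "0 \<le> (\<integral>y. (dist y q - dist y m) \<partial>\<nu>)" for q
    using assms(4)[unfolded frechet_median_def, rule_format, of m]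
    by (simp add: is_arg_min_linorder risk)
  obtain c where "0 < c" and var: "\<And>q. dist m q \<le> R \<Longrightarrow> c * (dist m q)\<^sup>2 \<le> (\<integral>y. (dist y q - dist y m) \<partial>\<nu>)"
    using median_variance_inequality[OF assms(2,4) \<open>0 < w\<close> less_imp_le[OF \<open>0 < R\<close>] assms(16)]
    by (auto simp: risk)

  \<comment> \<open>an empty block lies in every bow tie\<close>
  have "0 < l"
  proof (rule ccontr)
    assume "\<not> 0 < l"
    moreover have "m \<in> cball m R" using \<open>0 < R\<close> by simp
    ultimately have "?E = space M" by fastforce
    then show False using assms(17) by (simp add: prob_space)
  qed
  then have "1 \<le> l" by simp
  have "\<exists>A\<in>sets (L.P l). 0 < measure (L.P l) A \<and>
      (\<forall>y\<in>A. \<forall>(q, p)\<in>cball m R \<times> cball m R. \<exists>j\<in>{1..l}. y j \<notin> bow_tie q p w \<and> dist (y j) m \<le> R)"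
  proof (rule pos_measure_block[OF L.prob_space_P X_meas X_law[OF \<open>1 \<le> l\<close>]])
    show "cball m R \<times> cball m R \<noteq> {}" using \<open>0 < R\<close> by auto
    show "(\<lambda>y. INF (q, p)\<in>cball m R \<times> cball m R.
        1 / real l * (\<Sum>j=1..l. of_bool (y j \<notin> bow_tie q p w \<and> dist (y j) m \<le> R)))
      \<in> borel_measurable (completion (L.P l))"
      using assms(19)[OF \<open>1 \<le> l\<close>] by (simp add: \<nu>_def)
    show "\<not> (AE \<omega> in M. \<exists>(q, p)\<in>cball m R \<times> cball m R.
        \<forall>j\<in>{1..l}. \<not> (X l \<omega> j \<notin> bow_tie q p w \<and> dist (X l \<omega> j) m \<le> R))"
    proof
      assume "AE \<omega> in M. \<exists>(q, p)\<in>cball m R \<times> cball m R.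
        \<forall>j\<in>{1..l}. \<not> (X l \<omega> j \<notin> bow_tie q p w \<and> dist (X l \<omega> j) m \<le> R)"
      then have "AE \<omega> in M. \<exists>q\<in>cball m R. \<exists>p\<in>cball m R.
           \<forall>j\<in>{1..l}. Ys j \<omega> \<in> bow_tie q p w \<union> (UNIV - cball m R)"
        by eventually_elim (fastforce simp: X_def dist_commute)
      then have "prob ?E = 1" by (rule iffD2[OF prob_Collect_eq_1[OF assms(18)]])
      then show False using assms(17) by simp
    qed
  qed (rule \<open>0 < l\<close>)
  then obtain A where A: "A \<in> sets (L.P l)" "0 < measure (L.P l) A"
    and hits: "\<And>y q p. y \<in> A \<Longrightarrow> dist m q \<le> R \<Longrightarrow> dist m p \<le> R \<Longrightarrow>
      \<exists>j\<in>{1..l}. y j \<notin> bow_tie q p w \<and> dist (y j) m \<le> R"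
    by fastforce

  have int: "integrable \<nu> (\<lambda>y. dist y m powr \<xi>)"
    unfolding \<nu>_def using assms(10) by (subst integrable_distr_eq) measurable
  have far: "law.prob {y. r < dist y m} < 1 / 27"
  proof -
    have "{y. r < dist y m} \<in> sets borel" by measurable
    then have "law.prob {y. r < dist y m} = prob {\<omega>\<in>space M. r < dist (Y \<omega>) m}"
      unfolding \<nu>_def by (subst measure_distr) (auto simp: vimage_def Int_def conj_commute)
    then show ?thesis using assms(12) by simp
  qed
  have "\<exists>C n0. \<forall>n\<ge>n0. (\<integral>\<^sup>+y. ennreal ((dist m (med n y))\<^sup>2) \<partial>L.P n) \<le> ennreal (C / real n)"
    using assms(13) \<open>0 < r\<close>
    by (intro L.median_mean_square_rate[OF med_meas med_opt \<open>0 < r\<close> \<open>0 < w\<close> \<open>0 < \<xi>\<close> int far _ pos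
          \<open>0 < c\<close> var A(1) \<open>1 \<le> l\<close> A(2) hits]) auto
  then obtain C n0 where C: "\<And>n. n0 \<le> n \<Longrightarrow>
      (\<integral>\<^sup>+y. ennreal ((dist m (med n y))\<^sup>2) \<partial>L.P n) \<le> ennreal (C / real n)" by blast
  have "(\<integral>\<^sup>+\<omega>. ennreal ((dist m (med n (X n \<omega>)))\<^sup>2) \<partial>M) \<le> ennreal (C / real n)"
    if n: "max 1 n0 \<le> n" for n
  proof -
    note [measurable] = med_meas[of n] X_meas[of n]
    have "1 \<le> n" using n by simp
    have "(\<lambda>y. ennreal ((dist m (med n y))\<^sup>2)) \<in> borel_measurable (L.P n)"
      using \<open>1 \<le> n\<close> by measurable
    then have "(\<integral>\<^sup>+\<omega>. ennreal ((dist m (med n (X n \<omega>)))\<^sup>2) \<partial>M)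
        = (\<integral>\<^sup>+y. ennreal ((dist m (med n y))\<^sup>2) \<partial>distr M (L.P n) (X n))"
      by (intro nn_integral_distr[symmetric] X_meas) simp
    then show ?thesis using C[of n] n X_law[OF \<open>1 \<le> n\<close>] by simp
  qed
  then show ?thesis unfolding X_def by blast
qed

end
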